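(* Let $V$ be a finite-dimensional indecomposable calibrated representation of $A$ on which $e$ does not act by $0$. Then all simple composition factors of $V$ are $1$-dimensional, and there are $k,\ell\in\mathbb{N}$ with $\dim V=k+\ell$ and $(a_1,\dots,a_k,b_1,\dots,b_\ell)\in\mathbb{C}^{k+\ell}$ such that $y_1$ acts on $V$, with respect to a suitable basis, by $\mathrm{diag}(a_1,\dots,a_k,b_1-1,\dots,b_\ell-1)$, and $V$ is an extension of semisimple $A$-modules $$0\longrightarrow\bigoplus_{i=1}^k V_{a_i}^-\longrightarrow V\longrightarrow\bigoplus_{j=1}^\ell V_{b_j-1}^+\longrightarrow 0.$$ In particular, every simple calibrated representation of $A$ is obtained from a simple calibrated representation of the degenerate affine Hecke algebra $H$ by having $e$ act by $0$.
   Context: $A$ denotes the degenerate affine periplectic Brauer algebra on $2$ strands: the associative unital $\mathbb{C}$-algebra generated by $s,y_1,y_2,e$ with relations $$s^2=1,\quad y_1y_2=y_2y_1,\quad sy_1=y_2s-1-e,\quad sy_2=y_1s+1-e,$$ $$e^2=0,\quad es=e,\quad se=-e,\quad ey_2=ey_1+e,\quad y_1e=y_2e+e.$$ $H$ denotes the degenerate affine Hecke algebra: the $\mathbb{C}$-algebra generated by $s,y_1,y_2$ with relations $s^2=1$, $y_1y_2=y_2y_1$, $sy_1=y_2s-1$, $sy_2=y_1s+1$. One has $H\cong A/\langle e\rangle$, so every representation of $H$ is a representation of $A$ by letting $e$ act by $0$. A representation of $A$ or $H$ is called calibrated if it has a basis with respect to which the actions of $y_1$ and $y_2$ are both given by diagonal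 matrices. $\mathbb{N}=\{1,2,\dots\}$. For $a\in\mathbb{C}$, $V_a^+$ is the one-dimensional representation on which $y_1$ acts by $a$ and $s$ acts by $1$ (so $y_2$ acts by $a+1$ and $e$ by $0$); $V_a^-$ is the one-dimensional representation on which $y_1$ acts by $a$ and $s$ acts by $-1$ (so $y_2$ acts by $a-1$ and $e$ by $0$). *)

theory Defs
  imports "Jordan_Normal_Form.VS_Connect" "HOL-Algebra.QuotRing"
begin

section \<open>Vector spaces with a family of linear operators\<close>

text \<open>
  A representation of an algebra presented by generators and relations is a complex vector space
  with one linear operator per generator such that the operators satisfy the defining relations.
  In \<open>('v, 'g) rep\<close>, \<open>'v\<close> is the ambient type of vectors and \<open>'g\<close> the type of generators; the
  fields \<open>mult\<close> and \<open>one\<close> inherited from \<open>module\<close> carry no meaning. The scalars are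
  \<open>class_ring :: complex ring\<close>.
\<close>

record ('v, 'g) rep = "(complex, 'v) module" +
  act :: "'g \<Rightarrow> 'v \<Rightarrow> 'v"

definition operator_space :: "('v, 'g) rep \<Rightarrow> bool" where
  "operator_space M \<longleftrightarrow>
     vectorspace class_ring M \<and> (\<forall>g. linear_map class_ring M M (act M g))"

definition subrep :: "'v set \<Rightarrow> ('v, 'g) rep \<Rightarrow> bool" where
  "subrep W M \<longleftrightarrow>
     VectorSpace.subspace class_ring W M \<and> (\<forall>g. \<forall>w\<in>W. act M g w \<in> W)"

definition rep_hom :: "('v, 'g) rep \<Rightarrow> ('w, 'g) rep \<Rightarrow> ('v \<Rightarrow> 'w) \<Rightarrow> bool" where
  "rep_hom M N f \<longleftrightarrow>
     linear_map class_ring M N f \<and> (\<forall>g. \<forall>v\<in>carrier M. f (act M g v) = act N g (f v))"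

definition rep_iso :: "('v, 'g) rep \<Rightarrow> ('w, 'g) rep \<Rightarrow> bool" where
  "rep_iso M N \<longleftrightarrow> (\<exists>f. rep_hom M N f \<and> bij_betw f (carrier M) (carrier N))"

definition simple_rep :: "('v, 'g) rep \<Rightarrow> bool" where
  "simple_rep M \<longleftrightarrow>
     operator_space M \<and> carrier M \<noteq> {\<zero>\<^bsub>M\<^esub>} \<and>
     (\<forall>W. subrep W M \<longrightarrow> W = {\<zero>\<^bsub>M\<^esub>} \<or> W = carrier M)"

definition indecomposable_rep :: "('v, 'g) rep \<Rightarrow> bool" where
  "indecomposable_rep M \<longleftrightarrow>
     operator_space M \<and> carrier M \<noteq> {\<zero>\<^bsub>M\<^esub>} \<and>
     (\<forall>U W. subrep U M \<and> subrep W M \<and> U \<inter> W = {\<zero>\<^bsub>M\<^esub>} \<and> U <+>\<^bsub>M\<^esub> W = carrier M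
        \<longrightarrow> U = {\<zero>\<^bsub>M\<^esub>} \<or> W = {\<zero>\<^bsub>M\<^esub>})"

text \<open>A representation is semisimple if it is the sum of its simple subrepresentations.\<close>

definition semisimple_rep :: "('v, 'g) rep \<Rightarrow> bool" where
  "semisimple_rep M \<longleftrightarrow>
     operator_space M \<and>
     LinearCombinations.module.span class_ring M (\<Union>{W. subrep W M \<and> simple_rep (M\<lparr>carrier := W\<rparr>)}) = carrier M"

text \<open>
  The quotient has the cosets of \<open>W\<close> as elements. As in \<open>rcoset_mult\<close>, the operations on cosets are
  given by unions over representatives; all members of these unions coincide if \<open>subrep W M\<close>.
\<close>

definition quotient_rep :: "('v, 'g) rep \<Rightarrow> 'v set \<Rightarrow> ('v set, 'g) rep" where
  "quotient_rep M W =
     \<lparr>carrier = a_rcosets\<^bsub>M\<^esub> W, mult = undefined, one = undefined,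
      zero = W, add = set_add M,
      smult = (\<lambda>c X. \<Union>x\<in>X. W +>\<^bsub>M\<^esub> (c \<odot>\<^bsub>M\<^esub> x)),
      act = (\<lambda>g X. \<Union>x\<in>X. W +>\<^bsub>M\<^esub> act M g x)\<rparr>"

definition series_factor :: "('v, 'g) rep \<Rightarrow> 'v set list \<Rightarrow> nat \<Rightarrow> ('v set, 'g) rep" where
  "series_factor M Us i = quotient_rep (M\<lparr>carrier := Us ! Suc i\<rparr>) (Us ! i)"

definition composition_series :: "('v, 'g) rep \<Rightarrow> 'v set list \<Rightarrow> bool" where
  "composition_series M Us \<longleftrightarrow>
     Us \<noteq> [] \<and> hd Us = {\<zero>\<^bsub>M\<^esub>} \<and> last Us = carrier M \<and> (\<forall>U\<in>set Us. subrep U M) \<and>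
     (\<forall>i. Suc i < length Us \<longrightarrow>
        Us ! i \<subseteq> Us ! Suc i \<and> simple_rep (series_factor M Us i))"

definition composition_factor :: "('v, 'g) rep \<Rightarrow> ('v set, 'g) rep \<Rightarrow> bool" where
  "composition_factor M F \<longleftrightarrow>
     (\<exists>Us i. composition_series M Us \<and> Suc i < length Us \<and> F = series_factor M Us i)"

text \<open>\<open>vectorspace.dim\<close> is meaningful only in the finite-dimensional case.\<close>

definition has_dim :: "('v, 'g) rep \<Rightarrow> nat \<Rightarrow> bool" where
  "has_dim M n \<longleftrightarrow>
     vectorspace.fin_dim class_ring M \<and> vectorspace.dim class_ring M = n"

definition direct_sum_rep :: "'i set \<Rightarrow> ('i \<Rightarrow> ('v, 'g) rep) \<Rightarrow> ('i \<Rightarrow> 'v, 'g) rep" where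
  \<comment> \<open>for a finite index set \<open>I\<close>, where direct sum and direct product agree\<close>
  "direct_sum_rep I M =
     \<lparr>carrier = (\<Pi>\<^sub>E i\<in>I. carrier (M i)), mult = undefined, one = undefined,
      zero = (\<lambda>i\<in>I. \<zero>\<^bsub>M i\<^esub>),
      add = (\<lambda>f g. \<lambda>i\<in>I. f i \<oplus>\<^bsub>M i\<^esub> g i),
      smult = (\<lambda>c f. \<lambda>i\<in>I. c \<odot>\<^bsub>M i\<^esub> f i),
      act = (\<lambda>x f. \<lambda>i\<in>I. act (M i) x (f i))\<rparr>"

definition short_exact ::
  "('u, 'g) rep \<Rightarrow> ('u \<Rightarrow> 'v) \<Rightarrow> ('v, 'g) rep \<Rightarrow> ('v \<Rightarrow> 'w) \<Rightarrow> ('w, 'g) rep \<Rightarrow> bool" where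
  "short_exact L \<iota> M \<pi> N \<longleftrightarrow>
     rep_hom L M \<iota> \<and> rep_hom M N \<pi> \<and>
     inj_on \<iota> (carrier L) \<and> \<pi> ` carrier M = carrier N \<and>
     \<iota> ` carrier L = {v \<in> carrier M. \<pi> v = \<zero>\<^bsub>N\<^esub>}"

text \<open>\<open>calibrated Y M\<close>: some basis of \<open>M\<close> diagonalizes all the generators in \<open>Y\<close> simultaneously.\<close>

definition calibrated :: "'g set \<Rightarrow> ('v, 'g) rep \<Rightarrow> bool" where
  "calibrated Y M \<longleftrightarrow>
     (\<exists>B. vectorspace.basis class_ring M B \<and>
          (\<forall>y\<in>Y. \<forall>b\<in>B. \<exists>c. act M y b = c \<odot>\<^bsub>M\<^esub> b))"

text \<open>The generator \<open>g\<close> acts by \<open>diag(d 1, \<dots>, d n)\<close> with respect to some basis \<open>v 1, \<dots>, v n\<close>.\<close>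

definition acts_by_diag :: "('v, 'g) rep \<Rightarrow> 'g \<Rightarrow> nat \<Rightarrow> (nat \<Rightarrow> complex) \<Rightarrow> bool" where
  "acts_by_diag M g n d \<longleftrightarrow>
     (\<exists>v. inj_on v {1..n} \<and> vectorspace.basis class_ring M (v ` {1..n}) \<and>
          (\<forall>i\<in>{1..n}. act M g (v i) = d i \<odot>\<^bsub>M\<^esub> v i))"



section \<open>The degenerate affine periplectic Brauer algebra and the degenerate affine Hecke algebra\<close>

datatype A_gen = As | Ay1 | Ay2 | Ae

definition A_rep :: "('v, A_gen) rep \<Rightarrow> bool" where
  "A_rep M \<longleftrightarrow> operator_space M \<and>
     (let s = act M As; y1 = act M Ay1; y2 = act M Ay2; e = act M Ae in
      \<forall>v\<in>carrier M.
        s (s v) = v \<and>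
        y1 (y2 v) = y2 (y1 v) \<and>
        s (y1 v) = y2 (s v) \<ominus>\<^bsub>M\<^esub> v \<ominus>\<^bsub>M\<^esub> e v \<and>
        s (y2 v) = y1 (s v) \<oplus>\<^bsub>M\<^esub> v \<ominus>\<^bsub>M\<^esub> e v \<and>
        e (e v) = \<zero>\<^bsub>M\<^esub> \<and>
        e (s v) = e v \<and>
        s (e v) = \<ominus>\<^bsub>M\<^esub> e v \<and>
        e (y2 v) = e (y1 v) \<oplus>\<^bsub>M\<^esub> e v \<and>
        y1 (e v) = y2 (e v) \<oplus>\<^bsub>M\<^esub> e v)"

datatype H_gen = Hs | Hy1 | Hy2

definition H_rep :: "('v, H_gen) rep \<Rightarrow> bool" where
  "H_rep M \<longleftrightarrow> operator_space M \<and>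
     (let s = act M Hs; y1 = act M Hy1; y2 = act M Hy2 in
      \<forall>v\<in>carrier M.
        s (s v) = v \<and>
        y1 (y2 v) = y2 (y1 v) \<and>
        s (y1 v) = y2 (s v) \<ominus>\<^bsub>M\<^esub> v \<and>
        s (y2 v) = y1 (s v) \<oplus>\<^bsub>M\<^esub> v)"

abbreviation A_calibrated :: "('v, A_gen) rep \<Rightarrow> bool" where
  "A_calibrated M \<equiv> calibrated {Ay1, Ay2} M"

abbreviation H_calibrated :: "('v, H_gen) rep \<Rightarrow> bool" where
  "H_calibrated M \<equiv> calibrated {Hy1, Hy2} M"

text \<open>Pullback along the surjection of algebras that sends \<open>e\<close> to \<open>0\<close>.\<close>

definition inflate :: "('v, H_gen) rep \<Rightarrow> ('v, A_gen) rep" where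
  "inflate N =
     \<lparr>carrier = carrier N, mult = mult N, one = one N, zero = zero N, add = add N,
      smult = smult N,
      act = (\<lambda>g. case g of As \<Rightarrow> act N Hs | Ay1 \<Rightarrow> act N Hy1 | Ay2 \<Rightarrow> act N Hy2
                         | Ae \<Rightarrow> (\<lambda>v. \<zero>\<^bsub>N\<^esub>))\<rparr>"

definition scalar_rep :: "('g \<Rightarrow> complex) \<Rightarrow> (complex, 'g) rep" where
  "scalar_rep c =
     \<lparr>carrier = UNIV, mult = (*), one = 1, zero = 0, add = (+), smult = (*),
      act = (\<lambda>g v. c g * v)\<rparr>"

definition V_plus :: "complex \<Rightarrow> (complex, A_gen) rep" where
  "V_plus a =
     scalar_rep (\<lambda>g. case g of As \<Rightarrow> 1 | Ay1 \<Rightarrow> a | Ay2 \<Rightarrow> a + 1 | Ae \<Rightarrow> 0)"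

definition V_minus :: "complex \<Rightarrow> (complex, A_gen) rep" where
  "V_minus a =
     scalar_rep (\<lambda>g. case g of As \<Rightarrow> - 1 | Ay1 \<Rightarrow> a | Ay2 \<Rightarrow> a - 1 | Ae \<Rightarrow> 0)"

end

theory Submission
  imports Defs
begin

text \<open>
  Put \<open>z = y1 - y2\<close>. The relations give \<open>s z = - z s - 2\<close>, \<open>z e = e\<close> and \<open>e z = - e\<close>, so \<open>s\<close> commutes
  with \<open>q = z\<^sup>2 - 1\<close> and \<open>e q = 0\<close>. Let \<open>N\<close> and \<open>P\<close> be the eigenspaces of \<open>z\<close> for \<open>1\<close> and \<open>- 1\<close>.
  The space \<open>K\<close> of all \<open>x\<close> in \<open>N\<close> with \<open>s x = - x\<close> is a subrepresentation on which \<open>e\<close> vanishes; it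
  contains the images of \<open>e\<close> and of \<open>s - 1\<close> on \<open>P\<close>. The image \<open>I\<close> of \<open>s + 1\<close> on \<open>N\<close> is a
  subrepresentation inside \<open>P\<close> on which \<open>e\<close> vanishes too.

  If \<open>V\<close> is calibrated, then \<open>V\<close> is the direct sum of \<open>N\<close>, \<open>P\<close> and the image of \<open>q\<close>. With complements
  \<open>C\<close> of \<open>K\<close> in \<open>N\<close> and \<open>D\<close> of \<open>I\<close> in \<open>P\<close> that are spanned by members of the eigenbasis, \<open>V\<close> is the
  direct sum of the subrepresentations \<open>I + C + im q\<close> and \<open>D + K\<close>, and \<open>D + K\<close> contains the image of
  \<open>e\<close>. If \<open>V\<close> is indecomposable and \<open>e\<close> does not vanish, the first one is zero, that is, \<open>K = N\<close> and
  \<open>V = N + P\<close>. Hence \<open>N\<close> is a direct sum of representations \<open>V\<^sub>a\<^sup>-\<close> and \<open>V / N\<close> is a direct sum of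
  representations \<open>V\<^sub>a\<^sup>+\<close>.

  In a simple representation, \<open>K\<close> is zero or everything, and \<open>e\<close> vanishes in either case.
\<close>

section \<open>Vector spaces with coordinates\<close>

lemma vectorspace_classI:
  fixes V :: "(complex, 'v, 'x) module_scheme" (structure)
  assumes "\<zero> \<in> carrier V"
    and "\<And>x y. x \<in> carrier V \<Longrightarrow> y \<in> carrier V \<Longrightarrow> x \<oplus> y \<in> carrier V"
    and "\<And>x. x \<in> carrier V \<Longrightarrow> \<exists>y\<in>carrier V. x \<oplus> y = \<zero>"
    and "\<And>c x. x \<in> carrier V \<Longrightarrow> c \<odot> x \<in> carrier V"
    and "\<And>x y. x \<in> carrier V \<Longrightarrow> y \<in> carrier V \<Longrightarrow> x \<oplus> y = y \<oplus> x"
    and "\<And>x y z. x \<in> carrier V \<Longrightarrow> y \<in> carrier V \<Longrightarrow> z \<in> carrier V \<Longrightarrow> x \<oplus> y \<oplus> z = x \<oplus> (y \<oplus> z)"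
    and "\<And>x. x \<in> carrier V \<Longrightarrow> x \<oplus> \<zero> = x"
    and "\<And>a b x. x \<in> carrier V \<Longrightarrow> (a * b) \<odot> x = a \<odot> (b \<odot> x)"
    and "\<And>x. x \<in> carrier V \<Longrightarrow> 1 \<odot> x = x"
    and "\<And>a b x. x \<in> carrier V \<Longrightarrow> (a + b) \<odot> x = a \<odot> x \<oplus> b \<odot> x"
    and "\<And>a x y. x \<in> carrier V \<Longrightarrow> y \<in> carrier V \<Longrightarrow> a \<odot> (x \<oplus> y) = a \<odot> x \<oplus> a \<odot> y"
  shows "vectorspace class_ring V"
  by (rule vs_criteria[OF class_field]) (use assms in auto)

lemma linear_map_classI:
  fixes V :: "(complex, 'v, 'x) module_scheme" and W :: "(complex, 'w, 'y) module_scheme"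
  assumes "vectorspace class_ring V" "vectorspace class_ring W"
    and "\<And>x. x \<in> carrier V \<Longrightarrow> f x \<in> carrier W"
    and "\<And>x y. x \<in> carrier V \<Longrightarrow> y \<in> carrier V \<Longrightarrow> f (x \<oplus>\<^bsub>V\<^esub> y) = f x \<oplus>\<^bsub>W\<^esub> f y"
    and "\<And>c x. x \<in> carrier V \<Longrightarrow> f (c \<odot>\<^bsub>V\<^esub> x) = c \<odot>\<^bsub>W\<^esub> f x"
  shows "linear_map class_ring V W f"
  unfolding linear_map_def mod_hom_def mod_hom_axioms_def LinearCombinations.module_hom_def
  using assms by (auto simp: vectorspace_def)

locale cspace = vectorspace "class_ring :: complex ring" V
  for V :: "(complex, 'v, 'x) module_scheme" (structure)
begin

lemma smult_mem [simp, intro]: "x \<in> carrier V \<Longrightarrow> c \<odot> x \<in> carrier V"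
  using smult_closed[of c x] by simp

lemma smult_add_left: "x \<in> carrier V \<Longrightarrow> (a + b) \<odot> x = a \<odot> x \<oplus> b \<odot> x"
  using smult_l_distr[of a b x] by simp

lemma smult_add_right: "x \<in> carrier V \<Longrightarrow> y \<in> carrier V \<Longrightarrow> a \<odot> (x \<oplus> y) = a \<odot> x \<oplus> a \<odot> y"
  using smult_r_distr[of a x y] by simp

lemma smult_mult: "x \<in> carrier V \<Longrightarrow> (a * b) \<odot> x = a \<odot> (b \<odot> x)"
  using smult_assoc1[of a b x] by simp

lemma smult_1 [simp]: "x \<in> carrier V \<Longrightarrow> 1 \<odot> x = x"
  using smult_one[of x] by simp

lemma smult_0 [simp]: "x \<in> carrier V \<Longrightarrow> 0 \<odot> x = \<zero>"
  using smult_l_null[of x] by simp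

lemma smult_zero [simp]: "c \<odot> \<zero> = \<zero>"
  using smult_r_null[of c] by simp

lemma a_inv_smult: "x \<in> carrier V \<Longrightarrow> \<ominus> x = (- 1) \<odot> x"
  using smult_l_minus[of 1 x] by (simp add: class_ring_simps)

lemma subspaceI:
  assumes "W \<subseteq> carrier V" "\<zero> \<in> W"
    and "\<And>x y. x \<in> W \<Longrightarrow> y \<in> W \<Longrightarrow> x \<oplus> y \<in> W"
    and "\<And>c x. x \<in> W \<Longrightarrow> c \<odot> x \<in> W"
  shows "VectorSpace.subspace class_ring W V"
  unfolding subspace_def submodule_def using assms vectorspace_axioms module_axioms by auto

lemma subspaceD:
  assumes "VectorSpace.subspace class_ring W V"
  shows "W \<subseteq> carrier V" "\<zero> \<in> W" "x \<in> W \<Longrightarrow> y \<in> W \<Longrightarrow> x \<oplus> y \<in> W" "x \<in> W \<Longrightarrow> c \<odot> x \<in> W"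
    "x \<in> W \<Longrightarrow> \<ominus> x \<in> W" "x \<in> W \<Longrightarrow> y \<in> W \<Longrightarrow> x \<ominus> y \<in> W"
proof -
  interpret submodule class_ring W V using assms by (simp add: subspace_def)
  show W: "W \<subseteq> carrier V" "\<zero> \<in> W" "\<And>x y. x \<in> W \<Longrightarrow> y \<in> W \<Longrightarrow> x \<oplus> y \<in> W"
    and sm: "\<And>c x. x \<in> W \<Longrightarrow> c \<odot> x \<in> W"
    using subset zero_closed m_closed smult_closed by auto
  show neg: "\<And>x. x \<in> W \<Longrightarrow> \<ominus> x \<in> W" using W(1) sm a_inv_smult by (metis subsetD)
  show "\<And>x y. x \<in> W \<Longrightarrow> y \<in> W \<Longrightarrow> x \<ominus> y \<in> W" using neg W(3) by (simp add: a_minus_def)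
qed

lemma mem_set_add: "x \<in> U <+>\<^bsub>V\<^esub> W \<longleftrightarrow> (\<exists>u\<in>U. \<exists>w\<in>W. x = u \<oplus> w)"
  by (auto simp: set_add_def')

lemma subspace_set_add:
  assumes U: "VectorSpace.subspace class_ring U V" and W: "VectorSpace.subspace class_ring W V"
  shows "VectorSpace.subspace class_ring (U <+>\<^bsub>V\<^esub> W) V"
proof (rule subspaceI)
  note [simp] = subsetD[OF subspaceD(1)[OF U]] subsetD[OF subspaceD(1)[OF W]]
  show "U <+>\<^bsub>V\<^esub> W \<subseteq> carrier V" by (auto simp: mem_set_add)
  show "\<zero> \<in> U <+>\<^bsub>V\<^esub> W"
    unfolding mem_set_add using subspaceD(2)[OF U] subspaceD(2)[OF W] by force
  show "x \<oplus> y \<in> U <+>\<^bsub>V\<^esub> W" if "x \<in> U <+>\<^bsub>V\<^esub> W" "y \<in> U <+>\<^bsub>V\<^esub> W" for x y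
  proof -
    from that obtain u w u' w' where *: "u \<in> U" "w \<in> W" "u' \<in> U" "w' \<in> W"
      and "x = u \<oplus> w" "y = u' \<oplus> w'" by (auto simp: mem_set_add)
    then have "x \<oplus> y = (u \<oplus> u') \<oplus> (w \<oplus> w')"
      by (simp add: M.a_ac)
    then show ?thesis unfolding mem_set_add using subspaceD(3)[OF U] subspaceD(3)[OF W] * by metis
  qed
  show "c \<odot> x \<in> U <+>\<^bsub>V\<^esub> W" if "x \<in> U <+>\<^bsub>V\<^esub> W" for c x
    using that subspaceD(4)[OF U] subspaceD(4)[OF W]
    by (fastforce simp: mem_set_add smult_add_right)
qed

lemma subset_set_add:
  assumes U: "VectorSpace.subspace class_ring U V" and W: "VectorSpace.subspace class_ring W V"
  shows "U \<subseteq> U <+>\<^bsub>V\<^esub> W" "W \<subseteq> U <+>\<^bsub>V\<^esub> W"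
  using subspaceD(1,2)[OF U] subspaceD(1,2)[OF W] unfolding mem_set_add subset_iff
  by (metis M.r_zero, metis M.l_zero)

end

locale based_space = cspace V for V :: "(complex, 'v, 'x) module_scheme" (structure) +
  fixes B :: "'v set"
  assumes is_basis: "basis B"
begin

lemma basis_subset: "B \<subseteq> carrier V"
  using is_basis by (auto simp: basis_def)

lemma basis_carrier [simp]: "b \<in> B \<Longrightarrow> b \<in> carrier V"
  using basis_subset by auto

lemma basis_induct [consumes 1, case_names zero add smult basis]:
  assumes "x \<in> carrier V"
    and zero: "P \<zero>"
    and add: "\<And>x y. x \<in> carrier V \<Longrightarrow> y \<in> carrier V \<Longrightarrow> P x \<Longrightarrow> P y \<Longrightarrow> P (x \<oplus> y)"
    and smult: "\<And>c x. x \<in> carrier V \<Longrightarrow> P x \<Longrightarrow> P (c \<odot> x)"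
    and basis: "\<And>b. b \<in> B \<Longrightarrow> P b"
  shows "P x"
proof -
  have "span B \<subseteq> {x \<in> carrier V. P x}"
  proof (rule span_is_subset)
    have "VectorSpace.subspace class_ring {x \<in> carrier V. P x} V"
      by (intro subspaceI) (auto intro: zero add smult)
    then show "submodule class_ring {x \<in> carrier V. P x} V" by (simp add: subspace_def)
  qed (use basis in auto)
  then show ?thesis using assms(1) is_basis unfolding basis_def by auto
qed

definition expands :: "'v \<Rightarrow> ('v \<Rightarrow> complex) \<Rightarrow> bool" where
  "expands x a \<longleftrightarrow> (\<exists>A. finite A \<and> A \<subseteq> B \<and> (\<forall>b. b \<notin> A \<longrightarrow> a b = 0) \<and> lincomb a A = x)"

lemma lincomb_enlarge:
  assumes "finite A'" "A' \<subseteq> B" "A \<subseteq> A'" "\<forall>b. b \<notin> A \<longrightarrow> a b = 0"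
  shows "lincomb a A' = lincomb a A"
proof -
  have "lincomb a (A \<union> (A' - A)) = lincomb a A"
    by (rule lincomb_clean) (use assms basis_subset in \<open>auto intro: finite_subset\<close>)
  then show ?thesis using assms(3) by (simp add: Un_absorb1)
qed

lemma expands_basis: "b \<in> B \<Longrightarrow> expands b (\<lambda>b'. if b' = b then 1 else 0)"
  unfolding expands_def by (intro exI[of _ "{b}"]) (auto simp: lincomb_def)

lemma expands_zero: "expands \<zero> (\<lambda>b. 0)"
  unfolding expands_def by (intro exI[of _ "{}"]) auto

lemma expands_smult:
  assumes "expands x a" shows "expands (c \<odot> x) (\<lambda>b. c * a b)"
proof -
  from assms obtain A where A: "finite A" "A \<subseteq> B" "\<forall>b. b \<notin> A \<longrightarrow> a b = 0" "lincomb a A = x"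
    by (auto simp: expands_def)
  have "lincomb (\<lambda>b. c * a b) A = c \<odot> x"
    using lincomb_smult[of A a c] A basis_subset by auto
  then show ?thesis unfolding expands_def using A by (intro exI[of _ A]) auto
qed

lemma expands_add:
  assumes "expands x a" "expands y a'"
  shows "expands (x \<oplus> y) (\<lambda>b. a b + a' b)"
proof -
  from assms obtain A A' where A: "finite A" "A \<subseteq> B" "\<forall>b. b \<notin> A \<longrightarrow> a b = 0" "lincomb a A = x"
    and A': "finite A'" "A' \<subseteq> B" "\<forall>b. b \<notin> A' \<longrightarrow> a' b = 0" "lincomb a' A' = y"
    by (auto simp: expands_def)
  let ?S = "A \<union> A'"
  have "lincomb a ?S = x" "lincomb a' ?S = y"
    using lincomb_enlarge[of ?S A a] lincomb_enlarge[of ?S A' a'] A A' by auto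
  moreover have "lincomb (\<lambda>b. a b + a' b) ?S = lincomb a ?S \<oplus> lincomb a' ?S"
    using lincomb_sum[of ?S a a'] A A' basis_subset by (simp add: subset_trans[of _ B])
  ultimately show ?thesis unfolding expands_def using A A' by (intro exI[of _ ?S]) auto
qed

lemma expands_exists: "x \<in> carrier V \<Longrightarrow> \<exists>a. expands x a"
  by (induction rule: basis_induct)
    (blast intro: expands_zero expands_add expands_smult expands_basis)+

lemma expands_unique:
  assumes "x \<in> carrier V" "expands x a" "expands x a'"
  shows "a = a'"
proof -
  have "expands (x \<oplus> (- 1) \<odot> x) (\<lambda>b. a b + (- 1) * a' b)"
    by (intro expands_add expands_smult assms)
  moreover have "x \<oplus> (- 1) \<odot> x = \<zero>"
    using assms(1) by (simp add: M.r_neg flip: a_inv_smult)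
  ultimately obtain A where A: "finite A" "A \<subseteq> B" "\<And>b. b \<notin> A \<Longrightarrow> a b - a' b = 0"
    "lincomb (\<lambda>b. a b - a' b) A = \<zero>" by (auto simp: expands_def)
  then have "(\<lambda>b. a b - a' b) \<in> A \<rightarrow> {0}"
    using not_lindepD[of B A "\<lambda>b. a b - a' b"] is_basis by (simp add: basis_def)
  then have "a b = a' b" for b using A(3)[of b] by (cases "b \<in> A") auto
  then show ?thesis by auto
qed

definition coord :: "'v \<Rightarrow> 'v \<Rightarrow> complex" where
  "coord b x = (SOME a. expands x a) b"

lemma expands_coord: "x \<in> carrier V \<Longrightarrow> expands x (\<lambda>b. coord b x)"
  unfolding coord_def using someI_ex[OF expands_exists] by simp

lemma coord_eqI: "x \<in> carrier V \<Longrightarrow> expands x a \<Longrightarrow> coord b x = a b"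
  using expands_unique[OF _ expands_coord] by metis

lemma coord_outside: "x \<in> carrier V \<Longrightarrow> b \<notin> B \<Longrightarrow> coord b x = 0"
  using expands_coord[of x] unfolding expands_def by blast

lemma coord_add [simp]:
  "x \<in> carrier V \<Longrightarrow> y \<in> carrier V \<Longrightarrow> coord b (x \<oplus> y) = coord b x + coord b y"
  by (intro coord_eqI M.a_closed expands_add expands_coord)

lemma coord_smult [simp]: "x \<in> carrier V \<Longrightarrow> coord b (c \<odot> x) = c * coord b x"
  by (intro coord_eqI smult_mem expands_smult expands_coord)

lemma coord_zero [simp]: "coord b \<zero> = 0"
  by (intro coord_eqI M.zero_closed expands_zero)

lemma coord_uminus [simp]: "x \<in> carrier V \<Longrightarrow> coord b (\<ominus> x) = - coord b x"
  by (simp add: a_inv_smult)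

lemma coord_minus [simp]:
  "x \<in> carrier V \<Longrightarrow> y \<in> carrier V \<Longrightarrow> coord b (x \<ominus> y) = coord b x - coord b y"
  by (simp add: a_minus_def)

lemma coord_basis: "b' \<in> B \<Longrightarrow> coord b b' = (if b = b' then 1 else 0)"
  by (rule coord_eqI[OF basis_carrier expands_basis])

lemma coord_finsum:
  assumes "f \<in> I \<rightarrow> carrier V"
  shows "coord b (\<Oplus>i\<in>I. f i) = (\<Sum>i\<in>I. coord b (f i))"
  using assms by (induction I rule: infinite_finite_induct) (auto simp: Pi_def)

lemma coord_ext:
  assumes "x \<in> carrier V" "y \<in> carrier V" "\<And>b. b \<in> B \<Longrightarrow> coord b x = coord b y"
  shows "x = y"
proof -
  have "coord b x = coord b y" for b using assms coord_outside by (cases "b \<in> B") auto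
  then have eq: "(\<lambda>b. coord b x) = (\<lambda>b. coord b y)" by auto
  obtain A where A: "finite A" "A \<subseteq> B" "\<forall>b. b \<notin> A \<longrightarrow> coord b x = 0" "lincomb (\<lambda>b. coord b x) A = x"
    using expands_coord[OF assms(1)] by (auto simp: expands_def)
  obtain A' where A': "finite A'" "A' \<subseteq> B" "\<forall>b. b \<notin> A' \<longrightarrow> coord b y = 0" "lincomb (\<lambda>b. coord b y) A' = y"
    using expands_coord[OF assms(2)] by (auto simp: expands_def)
  let ?S = "A \<union> A'"
  have S: "finite ?S" "?S \<subseteq> B" using A A' by auto
  have 1: "lincomb (\<lambda>b. coord b x) ?S = x"
    by (rule trans[OF lincomb_enlarge[OF S _ A(3)] A(4)]) auto
  have 2: "lincomb (\<lambda>b. coord b y) ?S = y"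
    by (rule trans[OF lincomb_enlarge[OF S _ A'(3)] A'(4)]) auto
  show ?thesis by (rule trans[OF 1[symmetric] trans[OF arg_cong[OF eq, of "\<lambda>a. lincomb a ?S"] 2]])
qed

lemma coord_eq_0_iff: "x \<in> carrier V \<Longrightarrow> (\<forall>b\<in>B. coord b x = 0) \<longleftrightarrow> x = \<zero>"
  using coord_ext[of x \<zero>] by auto

definition cspan :: "'v set \<Rightarrow> 'v set" where
  "cspan S = {x \<in> carrier V. \<forall>b\<in>B - S. coord b x = 0}"

lemma subspace_cspan: "VectorSpace.subspace class_ring (cspan S) V"
  by (rule subspaceI) (auto simp: cspan_def)

lemma mem_cspan: "b \<in> S \<Longrightarrow> b \<in> B \<Longrightarrow> b \<in> cspan S"
  by (auto simp: cspan_def coord_basis)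

lemma complement_exists:
  assumes W: "VectorSpace.subspace class_ring W V" and S: "finite S" "S \<subseteq> B"
  obtains T where "T \<subseteq> S" "W \<inter> cspan T = {\<zero>}" "S \<subseteq> W <+>\<^bsub>V\<^esub> cspan T"
proof -
  let ?A = "{T. T \<subseteq> S \<and> W \<inter> cspan T = {\<zero>}}"
  note W0 = subspaceD(2)[OF W]
  have "{} \<in> ?A" using W0 coord_eq_0_iff by (auto simp: cspan_def)
  moreover have "finite ?A" using S by auto
  ultimately have "\<exists>T\<in>?A. \<forall>T'\<in>?A. T \<subseteq> T' \<longrightarrow> T = T'"
    using finite_has_maximal[of ?A] by (metis (no_types, lifting) empty_iff)
  then obtain T where T: "T \<in> ?A" and max: "\<And>T'. T' \<in> ?A \<Longrightarrow> T \<subseteq> T' \<Longrightarrow> T = T'"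
    by meson
  have "b \<in> W <+>\<^bsub>V\<^esub> cspan T" if b: "b \<in> S" for b
  proof (cases "b \<in> T")
    case True
    then show ?thesis
      using subset_set_add(2)[OF W subspace_cspan[of T]] mem_cspan[of b T] b S by auto
  next
    case False
    have "insert b T \<notin> ?A"
    proof
      assume "insert b T \<in> ?A"
      from max[OF this subset_insertI] False show False by (metis insertI1)
    qed
    then have "W \<inter> cspan (insert b T) \<noteq> {\<zero>}" using T b by simp
    moreover have "\<zero> \<in> W \<inter> cspan (insert b T)"
      using W0 subspaceD(2)[OF subspace_cspan] by simp
    ultimately obtain w where w: "w \<in> W" "w \<in> cspan (insert b T)" "w \<noteq> \<zero>"
      by blast
    have wC: "w \<in> carrier V" and bB: "b \<in> B" using w(2) b S by (auto simp: cspan_def)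
    let ?c = "coord b w"
    have c: "?c \<noteq> 0"
    proof
      assume "?c = 0"
      then have "w \<in> cspan T" using w(2) by (auto simp: cspan_def)
      with w T have "w \<in> {\<zero>}" by blast
      then show False using w(3) by simp
    qed
    let ?t = "b \<ominus> (1 / ?c) \<odot> w"
    have "?t \<in> cspan T"
      using w(2) wC bB c by (auto simp: cspan_def coord_basis)
    moreover have "(1 / ?c) \<odot> w \<in> W" using subspaceD(4)[OF W] w by auto
    moreover have "b = (1 / ?c) \<odot> w \<oplus> ?t"
      using wC bB by (intro coord_ext) auto
    ultimately show ?thesis unfolding mem_set_add by (intro bexI)
  qed
  then show ?thesis using T by (intro that[of T]) auto
qed

lemma full_subspaceI:
  assumes "VectorSpace.subspace class_ring W V" "B \<subseteq> W"
  shows "W = carrier V"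
proof -
  have "x \<in> W" if "x \<in> carrier V" for x
    using that by (induction rule: basis_induct) (use assms subspaceD[OF assms(1)] in auto)
  then show ?thesis using subspaceD(1)[OF assms(1)] by auto
qed

end

section \<open>Operators satisfying the relations\<close>

lemma subrepI:
  fixes M :: "('v, 'g) rep"
  assumes "VectorSpace.subspace class_ring W M" "\<And>g w. w \<in> W \<Longrightarrow> act M g w \<in> W"
  shows "subrep W M"
  using assms by (auto simp: subrep_def)

text \<open>The basis, which may be infinite, serves to verify identities between vectors coordinatewise.\<close>

locale A_module = based_space V B for V :: "('v, A_gen) rep" (structure) and B +
  assumes A_rep: "A_rep V"
begin

abbreviation s where "s \<equiv> act V As"
abbreviation y1 where "y1 \<equiv> act V Ay1"
abbreviation y2 where "y2 \<equiv> act V Ay2"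
abbreviation e where "e \<equiv> act V Ae"

lemma linear_act: "linear_map class_ring V V (act V g)"
  using A_rep[unfolded A_rep_def operator_space_def, THEN conjunct1, THEN conjunct2] by (rule spec)

lemma act_mem [simp, intro]: "x \<in> carrier V \<Longrightarrow> act V g x \<in> carrier V"
  by (rule linear_map.T_im[OF linear_act])

lemma act_add [simp]:
  "x \<in> carrier V \<Longrightarrow> y \<in> carrier V \<Longrightarrow> act V g (x \<oplus> y) = act V g x \<oplus> act V g y"
  by (rule linear_map.T_add[OF linear_act])

lemma act_smult [simp]: "x \<in> carrier V \<Longrightarrow> act V g (c \<odot> x) = c \<odot> act V g x"
  using linear_map.T_smult[OF linear_act, of c x g] by simp

lemma act_zero [simp]: "act V g \<zero> = \<zero>"
  by (rule linear_map.T0_is_0[OF linear_act])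

lemma act_uminus [simp]: "x \<in> carrier V \<Longrightarrow> act V g (\<ominus> x) = \<ominus> act V g x"
  by (simp add: a_inv_smult)

lemma act_minus [simp]:
  "x \<in> carrier V \<Longrightarrow> y \<in> carrier V \<Longrightarrow> act V g (x \<ominus> y) = act V g x \<ominus> act V g y"
  by (simp add: a_minus_def)

lemma relations:
  assumes "x \<in> carrier V"
  shows s_s: "s (s x) = x"
    and y1_y2: "y1 (y2 x) = y2 (y1 x)"
    and s_y1: "s (y1 x) = y2 (s x) \<ominus> x \<ominus> e x"
    and s_y2: "s (y2 x) = y1 (s x) \<oplus> x \<ominus> e x"
    and e_s: "e (s x) = e x"
    and s_e: "s (e x) = \<ominus> e x"
    and e_y2: "e (y2 x) = e (y1 x) \<oplus> e x"
    and y1_e: "y1 (e x) = y2 (e x) \<oplus> e x"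
  by ((insert A_rep[unfolded A_rep_def Let_def, THEN conjunct2, THEN bspec, OF assms], elim conjE, assumption)+)

lemma uminus_zero: "\<ominus> \<zero> = \<zero>"
  by (rule coord_ext) simp_all

lemma smult_uminus: "x \<in> carrier V \<Longrightarrow> c \<odot> \<ominus> x = \<ominus> (c \<odot> x)"
  by (rule coord_ext) simp_all

definition z where "z x = y1 x \<ominus> y2 x"

lemma z_mem [simp]: "x \<in> carrier V \<Longrightarrow> z x \<in> carrier V"
  by (simp add: z_def)

lemma z_add [simp]: "x \<in> carrier V \<Longrightarrow> y \<in> carrier V \<Longrightarrow> z (x \<oplus> y) = z x \<oplus> z y"
  by (rule coord_ext) (simp_all add: z_def)

lemma z_zero [simp]: "z \<zero> = \<zero>"
  by (simp add: z_def M.r_neg a_minus_def)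

lemma z_smult [simp]: "x \<in> carrier V \<Longrightarrow> z (c \<odot> x) = c \<odot> z x"
  by (rule coord_ext) (simp_all add: z_def algebra_simps)

lemma z_minus [simp]: "x \<in> carrier V \<Longrightarrow> y \<in> carrier V \<Longrightarrow> z (x \<ominus> y) = z x \<ominus> z y"
  by (simp add: a_minus_def a_inv_smult)

lemma z_uminus [simp]: "x \<in> carrier V \<Longrightarrow> z (\<ominus> x) = \<ominus> z x"
  by (simp add: a_inv_smult)

lemma s_z: "x \<in> carrier V \<Longrightarrow> s (z x) = \<ominus> z (s x) \<ominus> x \<ominus> x"
  by (rule coord_ext) (simp_all add: z_def s_y1 s_y2)

lemma coord_z_s: "x \<in> carrier V \<Longrightarrow> coord b (z (s x)) = - coord b (s (z x)) - 2 * coord b x"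
  by (simp add: s_z)

lemma z_e: "x \<in> carrier V \<Longrightarrow> z (e x) = e x"
  by (rule coord_ext) (simp_all add: z_def y1_e)

lemma e_z: "x \<in> carrier V \<Longrightarrow> e (z x) = \<ominus> e x"
  by (rule coord_ext) (simp_all add: z_def e_y2)

lemma y_z: "x \<in> carrier V \<Longrightarrow> y1 (z x) = z (y1 x)" "x \<in> carrier V \<Longrightarrow> y2 (z x) = z (y2 x)"
  by (rule coord_ext; simp add: z_def y1_y2)+

definition N where "N = {x \<in> carrier V. z x = x}"
definition P where "P = {x \<in> carrier V. z x = \<ominus> x}"
definition q where "q x = z (z x) \<ominus> x"
definition K where "K = {x \<in> N. s x = \<ominus> x}"

lemma e_q: "x \<in> carrier V \<Longrightarrow> e (q x) = \<zero>"
  by (rule coord_ext) (simp_all add: q_def e_z)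

lemma subspace_N: "VectorSpace.subspace class_ring N V"
  by (rule subspaceI) (auto simp: N_def)

lemma subspace_K: "VectorSpace.subspace class_ring K V"
  using subspaceD[OF subspace_N]
  by (intro subspaceI) (auto simp: K_def N_def M.minus_add smult_uminus uminus_zero)

lemma y1_N: "x \<in> N \<Longrightarrow> y1 x \<in> N" and y2_N: "x \<in> N \<Longrightarrow> y2 x \<in> N"
  by (simp_all add: N_def flip: y_z)

lemma e_N: assumes "x \<in> N" shows "e x = \<zero>"
proof -
  have x: "x \<in> carrier V" "z x = x" using assms by (auto simp: N_def)
  have "coord b (e x) = - coord b (e x)" for b
  proof -
    have "coord b (e (z x)) = - coord b (e x)" using x(1) by (simp add: e_z)
    then show ?thesis by (simp only: x(2))
  qed
  then show ?thesis by (intro coord_ext) (use x in simp_all)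
qed

lemma y2_of_N: "x \<in> N \<Longrightarrow> y2 x = y1 x \<ominus> x"
proof (rule coord_ext)
  fix b assume "x \<in> N"
  then have x: "x \<in> carrier V" "z x = x" by (auto simp: N_def)
  then have "coord b x = coord b (z x)" by simp
  also have "\<dots> = coord b (y1 x) - coord b (y2 x)" using x(1) by (simp add: z_def)
  finally show "coord b (y2 x) = coord b (y1 x \<ominus> x)" using x(1) by simp
qed (auto simp: N_def)

lemma y2_of_P: "x \<in> P \<Longrightarrow> y2 x = y1 x \<oplus> x"
proof (rule coord_ext)
  fix b assume "x \<in> P"
  then have x: "x \<in> carrier V" "z x = \<ominus> x" by (auto simp: P_def)
  then have "- coord b x = coord b (z x)" by simp
  also have "\<dots> = coord b (y1 x) - coord b (y2 x)" using x(1) by (simp add: z_def)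
  finally show "coord b (y2 x) = coord b (y1 x \<oplus> x)" using x(1) by (simp add: algebra_simps)
qed (auto simp: P_def)

lemma subrep_K: "subrep K V"
proof (rule subrepI[OF subspace_K])
  fix g x assume x: "x \<in> K"
  then have xN: "x \<in> N" and sx: "s x = \<ominus> x" by (auto simp: K_def)
  have xC: "x \<in> carrier V" using xN by (simp add: N_def)
  have y1: "y1 x \<in> K"
  proof -
    have "s (y1 x) = \<ominus> y1 x"
      using xC by (intro coord_ext) (simp_all add: s_y1 sx e_N[OF xN] y2_of_N[OF xN])
    then show ?thesis using y1_N[OF xN] by (simp add: K_def)
  qed
  show "act V g x \<in> K"
  proof (cases g)
    case As
    then show ?thesis using x subspaceD(5)[OF subspace_K] sx by simp
  next
    case Ay1
    then show ?thesis using y1 by simp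
  next
    case Ay2
    then show ?thesis using y1 x subspaceD(6)[OF subspace_K] by (simp add: y2_of_N[OF xN])
  next
    case Ae
    then show ?thesis using e_N[OF xN] subspaceD(2)[OF subspace_K] by simp
  qed
qed

lemma e_K: "x \<in> carrier V \<Longrightarrow> e x \<in> K"
  by (simp add: K_def N_def z_e s_e)

lemma s_P:
  assumes "x \<in> P" shows "s x \<ominus> x \<in> K"
proof -
  have x: "x \<in> carrier V" "z x = \<ominus> x" using assms by (auto simp: P_def)
  have "z (s x) = s x \<ominus> x \<ominus> x"
  proof (rule coord_ext)
    fix b
    show "coord b (z (s x)) = coord b (s x \<ominus> x \<ominus> x)"
      using x(1) coord_z_s[OF x(1), of b] by (simp add: x(2))
  qed (use x in auto)
  then have "z (s x \<ominus> x) = s x \<ominus> x"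
    using x by (intro coord_ext) simp_all
  moreover have "s (s x \<ominus> x) = \<ominus> (s x \<ominus> x)"
    using x by (intro coord_ext) (simp_all add: s_s)
  ultimately show ?thesis using x by (simp add: K_def N_def)
qed

definition I where "I = (\<lambda>x. s x \<oplus> x) ` N"

lemma I_props:
  assumes "x \<in> I"
  shows "x \<in> carrier V" "x \<in> P" "s x = x" "e x = \<zero>"
proof -
  obtain u where u: "u \<in> N" "x = s u \<oplus> u" using assms by (auto simp: I_def)
  have uC: "u \<in> carrier V" "z u = u" using u by (auto simp: N_def)
  show xC: "x \<in> carrier V" using u uC by simp
  have "z x = \<ominus> x"
  proof (rule coord_ext)
    fix b
    have "coord b (z (s u)) = - coord b (s u) - 2 * coord b u"
      using coord_z_s[OF uC(1), of b] by (simp add: uC(2))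
    then show "coord b (z x) = coord b (\<ominus> x)"
      using uC by (simp add: u(2))
  qed (use xC in auto)
  then show "x \<in> P" using xC by (simp add: P_def)
  show "s x = x" using uC u by (simp add: s_s M.a_comm)
  show "e x = \<zero>" using uC u by (simp add: e_s e_N)
qed

lemma I_sub_P: "I \<subseteq> P"
  using I_props by auto

lemma subspace_I: "VectorSpace.subspace class_ring I V"
proof (rule subspaceI)
  have N: "\<And>x. x \<in> N \<Longrightarrow> x \<in> carrier V" by (simp add: N_def)
  show "I \<subseteq> carrier V" using I_props by auto
  show "\<zero> \<in> I" unfolding I_def using subspaceD(2)[OF subspace_N] by (intro image_eqI[of _ _ \<zero>]) auto
  show "x \<oplus> y \<in> I" if xy: "x \<in> I" "y \<in> I" for x y
  proof -
    obtain u v where u: "u \<in> N" "x = s u \<oplus> u" and v: "v \<in> N" "y = s v \<oplus> v"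
      using xy by (auto simp: I_def)
    have "x \<oplus> y = s (u \<oplus> v) \<oplus> (u \<oplus> v)"
      using u v N by (intro coord_ext) simp_all
    then show ?thesis unfolding I_def using subspaceD(3)[OF subspace_N] u v by blast
  qed
  show "c \<odot> x \<in> I" if xy: "x \<in> I" for c x
  proof -
    obtain u where u: "u \<in> N" "x = s u \<oplus> u" using xy by (auto simp: I_def)
    have "c \<odot> x = s (c \<odot> u) \<oplus> c \<odot> u"
      using u N by (intro coord_ext) (simp_all add: algebra_simps)
    then show ?thesis unfolding I_def using subspaceD(4)[OF subspace_N] u by blast
  qed
qed

lemma y1_I: assumes "x \<in> I" shows "y1 x \<in> I"
proof -
  obtain u where u: "u \<in> N" "x = s u \<oplus> u" using assms by (auto simp: I_def)
  have uC: "u \<in> carrier V" using u by (auto simp: N_def)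
  have "y1 x = s (y2 u) \<oplus> y2 u"
  proof (rule coord_ext)
    fix b
    have "coord b (y2 u) = coord b (y1 u) - coord b u" using uC by (simp add: y2_of_N[OF u(1)])
    then show "coord b (y1 x) = coord b (s (y2 u) \<oplus> y2 u)"
      using uC u by (simp add: s_y2 e_N)
  qed (use uC u in simp_all)
  then show ?thesis unfolding I_def using y2_N[OF u(1)] by blast
qed

lemma subrep_I: "subrep I V"
proof (rule subrepI[OF subspace_I])
  fix g x assume x: "x \<in> I"
  show "act V g x \<in> I"
    using x y1_I[OF x] I_props[OF x] y2_of_P subspaceD(2,3)[OF subspace_I]
    by (cases g) auto
qed

definition V' where "V' = q ` carrier V"

lemma subspace_V': "VectorSpace.subspace class_ring V' V"
proof (rule subspaceI)
  show "V' \<subseteq> carrier V" by (auto simp: V'_def q_def)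
  show "\<zero> \<in> V'"
    unfolding V'_def by (intro image_eqI[of _ _ \<zero>]) (auto simp: q_def a_minus_def M.r_neg)
  show "x \<oplus> y \<in> V'" if xy: "x \<in> V'" "y \<in> V'" for x y
  proof -
    obtain u v where u: "u \<in> carrier V" "x = q u" and v: "v \<in> carrier V" "y = q v"
      using xy by (auto simp: V'_def)
    have "x \<oplus> y = q (u \<oplus> v)"
      using u v by (intro coord_ext) (simp_all add: q_def)
    then show ?thesis unfolding V'_def using u v by blast
  qed
  show "c \<odot> x \<in> V'" if xy: "x \<in> V'" for c x
  proof -
    obtain u where u: "u \<in> carrier V" "x = q u" using xy by (auto simp: V'_def)
    have "c \<odot> x = q (c \<odot> u)"
      using u by (intro coord_ext) (simp_all add: q_def algebra_simps)
    then show ?thesis unfolding V'_def using u by blast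
  qed
qed

lemma subrep_V': "subrep V' V"
proof (rule subrepI[OF subspace_V'])
  fix g x assume "x \<in> V'"
  then obtain u where u: "u \<in> carrier V" "x = q u" by (auto simp: V'_def)
  have "s (q u) = q (s u)"
  proof (rule coord_ext)
    fix b
    have "coord b (s (z (z u))) = coord b (z (z (s u)))"
      using u by (simp add: s_z)
    then show "coord b (s (q u)) = coord b (q (s u))" using u by (simp add: q_def)
  qed (use u in \<open>auto simp: q_def\<close>)
  then have "act V g x = q (act V g u)" if "g \<noteq> Ae"
    using that u by (cases g) (auto simp: q_def y_z)
  then show "act V g x \<in> V'"
    using u e_q[of u] subspaceD(2)[OF subspace_V'] by (cases "g = Ae") (auto simp: V'_def)
qed

end

section \<open>The decomposition of a calibrated representation\<close>

context A_module begin

lemma act_set_add: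
  assumes X: "VectorSpace.subspace class_ring X V" and Y: "VectorSpace.subspace class_ring Y V"
    and "\<And>g x. x \<in> X \<Longrightarrow> act V g x \<in> X <+>\<^bsub>V\<^esub> Y" "\<And>g y. y \<in> Y \<Longrightarrow> act V g y \<in> X <+>\<^bsub>V\<^esub> Y"
  shows "subrep (X <+>\<^bsub>V\<^esub> Y) V"
proof (rule subrepI[OF subspace_set_add[OF X Y]])
  fix g w assume "w \<in> X <+>\<^bsub>V\<^esub> Y"
  then obtain x y where "x \<in> X" "y \<in> Y" "w = x \<oplus> y" by (auto simp: mem_set_add)
  then have "act V g w = act V g x \<oplus> act V g y"
    using subspaceD(1)[OF X] subspaceD(1)[OF Y] by (auto intro: act_add)
  then show "act V g w \<in> X <+>\<^bsub>V\<^esub> Y"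
    using subspaceD(3)[OF subspace_set_add[OF X Y]] assms(3,4) \<open>x \<in> X\<close> \<open>y \<in> Y\<close> by simp
qed

end

locale calibrated_A_module = A_module V B for V :: "('v, A_gen) rep" (structure) and B +
  fixes \<alpha> \<beta> :: "'v \<Rightarrow> complex"
  assumes finite_B: "finite B"
    and y1_basis: "b \<in> B \<Longrightarrow> y1 b = \<alpha> b \<odot> b"
    and y2_basis: "b \<in> B \<Longrightarrow> y2 b = \<beta> b \<odot> b"
begin

lemma coord_y1:
  assumes "x \<in> carrier V" shows "coord b (y1 x) = \<alpha> b * coord b x"
  using assms
  by (induction rule: basis_induct) (auto simp: algebra_simps y1_basis coord_basis)

lemma coord_y2:
  assumes "x \<in> carrier V" shows "coord b (y2 x) = \<beta> b * coord b x"
  using assms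
  by (induction rule: basis_induct) (auto simp: algebra_simps y2_basis coord_basis)

lemma coord_z: "x \<in> carrier V \<Longrightarrow> coord b (z x) = (\<alpha> b - \<beta> b) * coord b x"
  by (simp add: z_def coord_y1 coord_y2 algebra_simps)

lemma coord_q: "x \<in> carrier V \<Longrightarrow> coord b (q x) = ((\<alpha> b - \<beta> b)\<^sup>2 - 1) * coord b x"
  by (simp add: q_def coord_z algebra_simps power2_eq_square)

definition B\<^sub>N where "B\<^sub>N = {b \<in> B. \<alpha> b - \<beta> b = 1}"
definition B\<^sub>P where "B\<^sub>P = {b \<in> B. \<alpha> b - \<beta> b = - 1}"

lemma N_eq: "N = cspan B\<^sub>N"
proof (rule Set.set_eqI)
  fix x
  show "x \<in> N \<longleftrightarrow> x \<in> cspan B\<^sub>N"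
  proof (cases "x \<in> carrier V")
    case True
    have "z x = x \<longleftrightarrow> (\<forall>b\<in>B. coord b (z x) = coord b x)"
      using coord_ext[of "z x" x] True by auto
    then show ?thesis using True by (auto simp: N_def cspan_def B\<^sub>N_def coord_z)
  qed (auto simp: N_def cspan_def)
qed

lemma P_eq: "P = cspan B\<^sub>P"
proof (rule Set.set_eqI)
  fix x
  have *: "(\<alpha> b - \<beta> b) * t = - t \<longleftrightarrow> \<alpha> b - \<beta> b = - 1 \<or> t = 0" for b t
    by (metis add.inverse_inverse minus_mult_minus mult_cancel_right1 mult_minus1 mult_cancel_right)
  show "x \<in> P \<longleftrightarrow> x \<in> cspan B\<^sub>P"
  proof (cases "x \<in> carrier V")
    case True
    have "z x = \<ominus> x \<longleftrightarrow> (\<forall>b\<in>B. coord b (z x) = coord b (\<ominus> x))"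
      using coord_ext[of "z x" "\<ominus> x"] True by auto
    then show ?thesis using True by (auto simp: P_def cspan_def B\<^sub>P_def coord_z *)
  qed (auto simp: P_def cspan_def)
qed

lemma coord_V':
  assumes "x \<in> V'" "b \<in> B\<^sub>N \<union> B\<^sub>P" shows "coord b x = 0"
  using assms by (auto simp: V'_def coord_q B\<^sub>N_def B\<^sub>P_def)

lemma coord_N: "x \<in> N \<Longrightarrow> b \<notin> B\<^sub>N \<Longrightarrow> coord b x = 0"
  and coord_P: "x \<in> P \<Longrightarrow> b \<notin> B\<^sub>P \<Longrightarrow> coord b x = 0"
  using coord_outside unfolding N_eq P_eq cspan_def by (cases "b \<in> B"; auto)+

lemma B\<^sub>N_B\<^sub>P: "B\<^sub>N \<subseteq> B" "B\<^sub>P \<subseteq> B" "B\<^sub>N \<inter> B\<^sub>P = {}"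
  by (auto simp: B\<^sub>N_def B\<^sub>P_def)

lemma basis_V':
  assumes b: "b \<in> B - (B\<^sub>N \<union> B\<^sub>P)" shows "b \<in> V'"
proof -
  let ?c = "(\<alpha> b - \<beta> b)\<^sup>2 - 1"
  have c: "?c \<noteq> 0"
    using b power2_eq_1_iff[of "\<alpha> b - \<beta> b"] by (auto simp: B\<^sub>N_def B\<^sub>P_def)
  have *: "b = q ((1 / ?c) \<odot> b)"
  proof (rule coord_ext)
    fix b'
    show "coord b' b = coord b' (q ((1 / ?c) \<odot> b))"
      using b c by (simp add: coord_q coord_basis)
  qed (use b in \<open>auto simp: q_def\<close>)
  show ?thesis unfolding V'_def by (rule image_eqI[where f = q, OF *]) (use b in simp)
qed

lemma y_cspan:
  assumes "x \<in> cspan T" shows "y1 x \<in> cspan T" "y2 x \<in> cspan T"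
  using assms by (auto simp: cspan_def coord_y1 coord_y2)

lemma decomposition:
  obtains U W where "subrep U V" "subrep W V" "U \<inter> W = {\<zero>}" "U <+>\<^bsub>V\<^esub> W = carrier V"
    "I \<subseteq> U" "V' \<subseteq> U" "K \<subseteq> W"
proof -
  obtain S where S: "S \<subseteq> B\<^sub>N" "K \<inter> cspan S = {\<zero>}" "B\<^sub>N \<subseteq> K <+>\<^bsub>V\<^esub> cspan S"
    using complement_exists[OF subspace_K, of B\<^sub>N] B\<^sub>N_B\<^sub>P finite_B finite_subset by metis
  obtain T where T: "T \<subseteq> B\<^sub>P" "I \<inter> cspan T = {\<zero>}" "B\<^sub>P \<subseteq> I <+>\<^bsub>V\<^esub> cspan T"
    using complement_exists[OF subspace_I, of B\<^sub>P] B\<^sub>N_B\<^sub>P finite_B finite_subset by metis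
  have SN: "cspan S \<subseteq> N" unfolding N_eq using S(1) by (auto simp: cspan_def)
  have TP: "cspan T \<subseteq> P" unfolding P_eq using T(1) by (auto simp: cspan_def)
  have IS: "subrep (I <+>\<^bsub>V\<^esub> cspan S) V"
  proof (rule act_set_add[OF subspace_I subspace_cspan])
    note sub = subset_set_add[OF subspace_I subspace_cspan[of S]]
    fix g
    show "act V g x \<in> I <+>\<^bsub>V\<^esub> cspan S" if "x \<in> I" for x
      using sub subrep_I that by (auto simp: subrep_def)
    show "act V g x \<in> I <+>\<^bsub>V\<^esub> cspan S" if x: "x \<in> cspan S" for x
    proof (cases g)
      case As
      have xN: "x \<in> N" using x SN by auto
      then have xC: "x \<in> carrier V" by (simp add: N_def)
      have "s x = (s x \<oplus> x) \<oplus> \<ominus> x" using xC by (intro coord_ext) auto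
      moreover have "s x \<oplus> x \<in> I" "\<ominus> x \<in> cspan S"
        using xN subspaceD(5)[OF subspace_cspan x] by (auto simp: I_def)
      ultimately show ?thesis unfolding mem_set_add As by blast
    next
      case Ae
      have "e x = \<zero>" using e_N x SN by blast
      then show ?thesis using Ae sub subspaceD(2)[OF subspace_I] by auto
    qed (use y_cspan[OF x] sub in auto)
  qed
  then have sIS: "VectorSpace.subspace class_ring (I <+>\<^bsub>V\<^esub> cspan S) V" by (simp add: subrep_def)
  let ?U = "(I <+>\<^bsub>V\<^esub> cspan S) <+>\<^bsub>V\<^esub> V'" and ?W = "cspan T <+>\<^bsub>V\<^esub> K"
  have U: "subrep ?U V"
    using act_set_add[OF sIS subspace_V'] subset_set_add[OF sIS subspace_V'] IS subrep_V'
    unfolding subrep_def by blast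
  have W: "subrep ?W V"
  proof (rule act_set_add[OF subspace_cspan subspace_K])
    note sub = subset_set_add[OF subspace_cspan[of T] subspace_K]
    fix g
    show "act V g x \<in> cspan T <+>\<^bsub>V\<^esub> K" if "x \<in> K" for x
      using sub subrep_K that by (auto simp: subrep_def)
    show "act V g x \<in> cspan T <+>\<^bsub>V\<^esub> K" if x: "x \<in> cspan T" for x
    proof (cases g)
      case As
      have xP: "x \<in> P" using x TP by auto
      then have xC: "x \<in> carrier V" by (simp add: P_def)
      have "s x = x \<oplus> (s x \<ominus> x)" using xC by (intro coord_ext) auto
      then show ?thesis unfolding mem_set_add As using x s_P[OF xP] by blast
    next
      case Ae
      have "x \<in> carrier V" using x by (simp add: cspan_def)
      then show ?thesis using Ae e_K sub by auto
    qed (use y_cspan[OF x] sub in auto)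
  qed
  note sU = U[unfolded subrep_def, THEN conjunct1] and sW = W[unfolded subrep_def, THEN conjunct1]
  have "?U \<inter> ?W \<subseteq> {\<zero>}"
  proof
    fix x assume "x \<in> ?U \<inter> ?W"
    then have "x \<in> ?U" "x \<in> ?W" by auto
    then obtain j v p k where j: "x = j \<oplus> v" "j \<in> I <+>\<^bsub>V\<^esub> cspan S"
      and x: "x = p \<oplus> k" and "v \<in> V'" "p \<in> cspan T" "k \<in> K"
      unfolding mem_set_add[of x] by blast
    moreover from j(2) obtain i n where "j = i \<oplus> n" "i \<in> I" "n \<in> cspan S"
      by (auto simp: mem_set_add)
    ultimately have x: "x = i \<oplus> n \<oplus> v" "x = p \<oplus> k"
      and mem: "i \<in> I" "n \<in> cspan S" "v \<in> V'" "p \<in> cspan T" "k \<in> K"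
      by simp_all
    have PN: "i \<in> P" "n \<in> N" "p \<in> P" "k \<in> N"
      using mem I_sub_P SN TP by (auto simp: K_def)
    have C: "i \<in> carrier V" "n \<in> carrier V" "v \<in> carrier V" "p \<in> carrier V" "k \<in> carrier V"
      using PN mem subspaceD(1)[OF subspace_V'] by (auto simp: P_def N_def)
    have eq: "coord b i + coord b n + coord b v = coord b p + coord b k" for b
      using C x coord_add[of "i \<oplus> n" v b] coord_add[of p k b] by simp
    have "i = p"
    proof (rule coord_ext)
      fix b
      show "coord b i = coord b p"
      proof (cases "b \<in> B\<^sub>P")
        case True
        then have "b \<notin> B\<^sub>N" using B\<^sub>N_B\<^sub>P(3) by blast
        then show ?thesis
          using eq[of b] coord_N[OF PN(2)] coord_N[OF PN(4)] coord_V'[OF mem(3)] True by simp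
      qed (simp add: coord_P[OF PN(1)] coord_P[OF PN(3)])
    qed (use C in auto)
    then have p0: "p = \<zero>" using mem T(2) by blast
    have "n = k"
    proof (rule coord_ext)
      fix b
      show "coord b n = coord b k"
      proof (cases "b \<in> B\<^sub>N")
        case True
        then have "b \<notin> B\<^sub>P" using B\<^sub>N_B\<^sub>P(3) by blast
        then show ?thesis
          using eq[of b] coord_P[OF PN(1)] coord_P[OF PN(3)] coord_V'[OF mem(3)] True by simp
      qed (simp add: coord_N[OF PN(2)] coord_N[OF PN(4)])
    qed (use C in auto)
    then have "k = \<zero>" using mem S(2) by blast
    then show "x \<in> {\<zero>}" using p0 x(2) by simp
  qed
  then have int: "?U \<inter> ?W = {\<zero>}" using subspaceD(2)[OF sU] subspaceD(2)[OF sW] by auto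
  have sub: "I \<subseteq> ?U" "cspan S \<subseteq> ?U" "V' \<subseteq> ?U" "cspan T \<subseteq> ?W" "K \<subseteq> ?W"
    using subset_set_add[OF subspace_I subspace_cspan[of S]] subset_set_add[OF sIS subspace_V']
      subset_set_add[OF subspace_cspan[of T] subspace_K] by auto
  note subUW = subset_set_add[OF sU sW]
  have sum: "?U <+>\<^bsub>V\<^esub> ?W = carrier V"
  proof (rule full_subspaceI[OF subspace_set_add[OF sU sW]], rule subsetI)
    fix b assume "b \<in> B"
    then consider "b \<in> B\<^sub>N" | "b \<in> B\<^sub>P" | "b \<in> B - (B\<^sub>N \<union> B\<^sub>P)" by blast
    then show "b \<in> ?U <+>\<^bsub>V\<^esub> ?W"
    proof cases
      case 1
      then obtain k n where kn: "k \<in> K" "n \<in> cspan S" "b = k \<oplus> n"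
        using S(3) unfolding subset_iff mem_set_add by blast
      then show ?thesis
        using sub subUW subspaceD(3)[OF subspace_set_add[OF sU sW], of k n] by blast
    next
      case 2
      then obtain k n where kn: "k \<in> I" "n \<in> cspan T" "b = k \<oplus> n"
        using T(3) unfolding subset_iff mem_set_add by blast
      then show ?thesis
        using sub subUW subspaceD(3)[OF subspace_set_add[OF sU sW], of k n] by blast
    next
      case 3
      then show ?thesis using basis_V' sub subUW by blast
    qed
  qed
  show ?thesis using that[OF U W int sum] sub by simp
qed

lemma indecomposable_structure:
  assumes "indecomposable_rep V" and "\<exists>v\<in>carrier V. e v \<noteq> \<zero>"
  shows "K = N" "B = B\<^sub>N \<union> B\<^sub>P"
proof -
  obtain U W where UW: "subrep U V" "subrep W V" "U \<inter> W = {\<zero>}" "U <+>\<^bsub>V\<^esub> W = carrier V"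
    and sub: "I \<subseteq> U" "V' \<subseteq> U" "K \<subseteq> W" using decomposition by metis
  have "W \<noteq> {\<zero>}" using assms(2) e_K sub by blast
  then have U0: "U = {\<zero>}" using assms(1) UW unfolding indecomposable_rep_def by blast
  have "s x = \<ominus> x" if x: "x \<in> N" for x
  proof (rule coord_ext)
    have xC: "x \<in> carrier V" using x by (simp add: N_def)
    have "s x \<oplus> x = \<zero>" using x U0 sub by (auto simp: I_def)
    then have "coord b (s x \<oplus> x) = 0" for b by simp
    then show "coord b (s x) = coord b (\<ominus> x)" for b
      using xC by (simp add: eq_neg_iff_add_eq_0)
  qed (use x in \<open>auto simp: N_def\<close>)
  then show "K = N" by (auto simp: K_def)
  show "B = B\<^sub>N \<union> B\<^sub>P"
  proof (rule ccontr)
    assume "B \<noteq> B\<^sub>N \<union> B\<^sub>P"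
    then obtain b where b: "b \<in> B - (B\<^sub>N \<union> B\<^sub>P)" using B\<^sub>N_B\<^sub>P by blast
    then have "b = \<zero>" using basis_V' U0 sub by blast
    then show False using coord_basis[of b b] b by simp
  qed
qed

end

section \<open>Direct sums of one-dimensional representations\<close>

lemma operator_space_subrep:
  fixes M :: "('v, 'g) rep"
  assumes "operator_space M" "subrep W M"
  shows "operator_space (M\<lparr>carrier := W\<rparr>)"
proof -
  have vs: "vectorspace class_ring M" and lin: "\<And>g. linear_map class_ring M M (act M g)"
    using assms(1) by (auto simp: operator_space_def)
  interpret cspace M using vs by (simp add: cspace_def)
  have W: "VectorSpace.subspace class_ring W M" "\<And>g w. w \<in> W \<Longrightarrow> act M g w \<in> W"
    using assms(2) by (auto simp: subrep_def)
  have vsW: "vectorspace class_ring (M\<lparr>carrier := W\<rparr>)" by (rule subspace_is_vs[OF W(1)])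
  have mem: "w \<in> W \<Longrightarrow> w \<in> carrier M" for w using subspaceD(1)[OF W(1)] by auto
  have "linear_map class_ring (M\<lparr>carrier := W\<rparr>) (M\<lparr>carrier := W\<rparr>) (act (M\<lparr>carrier := W\<rparr>) g)" for g
    using vsW W(2) linear_map.T_add[OF lin[of g] mem mem] linear_map.T_smult[OF lin[of g] _ mem]
    by (intro linear_map_classI) auto
  then show ?thesis using vsW by (simp add: operator_space_def)
qed

locale scalar_sum =
  fixes I :: "'i set" and c :: "'i \<Rightarrow> 'g \<Rightarrow> complex"
  assumes finite_I: "finite I"
begin

abbreviation D where "D \<equiv> direct_sum_rep I (\<lambda>i. scalar_rep (c i))"

lemma carrier_D [simp]: "carrier D = extensional I"
  by (simp add: direct_sum_rep_def scalar_rep_def PiE_def Pi_def)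

lemma add_D [simp]: "f \<oplus>\<^bsub>D\<^esub> g = (\<lambda>i\<in>I. f i + g i)"
  and smult_D [simp]: "a \<odot>\<^bsub>D\<^esub> f = (\<lambda>i\<in>I. a * f i)"
  and zero_D [simp]: "\<zero>\<^bsub>D\<^esub> = (\<lambda>i\<in>I. 0)"
  and act_D [simp]: "act D x f = (\<lambda>i\<in>I. c i x * f i)"
  by (simp_all add: direct_sum_rep_def scalar_rep_def)

lemma ext_D: "f \<in> extensional I \<Longrightarrow> g \<in> extensional I \<Longrightarrow> (\<And>i. i \<in> I \<Longrightarrow> f i = g i) \<Longrightarrow> f = g"
  by (rule extensionalityI)

lemma vectorspace_D: "vectorspace class_ring D"
proof (rule vectorspace_classI)
  show "\<exists>y\<in>carrier D. x \<oplus>\<^bsub>D\<^esub> y = \<zero>\<^bsub>D\<^esub>" if "x \<in> carrier D" for x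
    by (intro bexI[of _ "\<lambda>i\<in>I. - x i"]) auto
qed (auto intro!: ext_D simp: algebra_simps)

sublocale D: cspace D
  using vectorspace_D by (simp add: cspace_def)

lemma operator_space_D: "operator_space D"
  unfolding operator_space_def
  by (intro conjI allI vectorspace_D linear_map_classI) (auto intro!: ext_D simp: algebra_simps)

lemma uminus_D: "f \<in> extensional I \<Longrightarrow> \<ominus>\<^bsub>D\<^esub> f = (\<lambda>i\<in>I. - f i)"
  using D.a_inv_smult[of f] by (auto intro!: ext_D)

lemma minus_D: "f \<in> extensional I \<Longrightarrow> g \<in> extensional I \<Longrightarrow> f \<ominus>\<^bsub>D\<^esub> g = (\<lambda>i\<in>I. f i - g i)"
  unfolding a_minus_def by (auto intro!: ext_D simp: uminus_D)

definition line :: "'i \<Rightarrow> ('i \<Rightarrow> complex) set" where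
  "line i = {f \<in> extensional I. \<forall>j\<in>I - {i}. f j = 0}"

lemma subrep_line: "subrep (line i) D"
  unfolding subrep_def by (intro conjI D.subspaceI) (auto simp: line_def)

lemma simple_line:
  assumes "i \<in> I" shows "simple_rep (D\<lparr>carrier := line i\<rparr>)"
proof -
  let ?L = "D\<lparr>carrier := line i\<rparr>"
  have op: "operator_space ?L" by (rule operator_space_subrep[OF operator_space_D subrep_line])
  then interpret L: cspace ?L by (simp add: cspace_def operator_space_def)
  have one: "(\<lambda>j\<in>I. if j = i then 1 else 0) \<in> line i"
    by (auto simp: line_def)
  have "line i \<noteq> {\<zero>\<^bsub>D\<^esub>}"
  proof
    assume eq: "line i = {\<zero>\<^bsub>D\<^esub>}"
    have "(\<lambda>j\<in>I. if j = i then 1 else 0) = (\<lambda>j\<in>I. 0 :: complex)"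
      using one unfolding eq zero_D by (rule singletonD)
    from fun_cong[OF this, of i] assms show False by simp
  qed
  moreover have "W = {\<zero>\<^bsub>D\<^esub>} \<or> W = line i" if "subrep W ?L" for W
  proof (rule disjCI)
    assume W': "W \<noteq> line i"
    have W: "VectorSpace.subspace class_ring W ?L" using that by (simp add: subrep_def)
    have sub: "W \<subseteq> line i" using L.subspaceD(1)[OF W] by simp
    have "f = \<zero>\<^bsub>D\<^esub>" if f: "f \<in> W" for f
    proof (rule ccontr)
      assume "f \<noteq> \<zero>\<^bsub>D\<^esub>"
      moreover have fl: "f \<in> extensional I" "\<And>j. j \<in> I \<Longrightarrow> j \<noteq> i \<Longrightarrow> f j = 0"
        using f sub by (auto simp: line_def)
      ultimately have fi: "f i \<noteq> 0"
        using ext_D[of f "\<zero>\<^bsub>D\<^esub>"] by (metis zero_D restrict_apply' restrict_extensional)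
      have "g \<in> W" if g: "g \<in> line i" for g
      proof -
        have "(g i / f i) \<odot>\<^bsub>D\<^esub> f = g"
        proof (rule ext_D)
          show "((g i / f i) \<odot>\<^bsub>D\<^esub> f) j = g j" if "j \<in> I" for j
            using that g fl fi by (cases "j = i") (auto simp: line_def)
        qed (use g in \<open>auto simp: line_def\<close>)
        then show ?thesis using L.subspaceD(4)[OF W f, of "g i / f i"] by simp
      qed
      then show False using W' sub by blast
    qed
    moreover have "\<zero>\<^bsub>D\<^esub> \<in> W" using L.subspaceD(2)[OF W] by simp
    ultimately show "W = {\<zero>\<^bsub>D\<^esub>}" by blast
  qed
  ultimately show ?thesis using op by (simp add: simple_rep_def)
qed

lemma semisimple_D: "semisimple_rep D"
proof -
  let ?S = "\<Union>{W. subrep W D \<and> simple_rep (D\<lparr>carrier := W\<rparr>)}"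
  have S: "?S \<subseteq> carrier D"
    using D.subspaceD(1) by (fastforce simp: subrep_def)
  have lines: "line i \<subseteq> D.span ?S" if "i \<in> I" for i
    using D.in_own_span[OF S] subrep_line simple_line[OF that] by blast
  have sp: "VectorSpace.subspace class_ring (D.span ?S) D"
    by (rule D.span_is_subspace[OF S])
  have "(\<lambda>i\<in>I. if i \<in> J then f i else 0) \<in> D.span ?S" if "finite J" "J \<subseteq> I" for J f
    using that
  proof (induction J rule: finite_induct)
    case empty
    have eq: "(\<lambda>i\<in>I. if i \<in> {} then f i else 0) = \<zero>\<^bsub>D\<^esub>" by (rule ext_D) auto
    show ?case unfolding eq by (rule D.subspaceD(2)[OF sp])
  next
    case (insert j J)
    have "(\<lambda>i\<in>I. if i = j then f i else 0) \<in> line j" by (auto simp: line_def)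
    then have mem: "(\<lambda>i\<in>I. if i = j then f i else 0) \<in> D.span ?S" using lines insert by blast
    have eq: "(\<lambda>i\<in>I. if i \<in> insert j J then f i else 0) =
      (\<lambda>i\<in>I. if i = j then f i else 0) \<oplus>\<^bsub>D\<^esub> (\<lambda>i\<in>I. if i \<in> J then f i else 0)"
      using insert by (intro ext_D) auto
    show ?case unfolding eq using insert by (intro D.subspaceD(3)[OF sp mem] insert.IH) blast
  qed
  note mem = this[OF finite_I subset_refl]
  have "f \<in> D.span ?S" if "f \<in> extensional I" for f
  proof -
    have eq: "f = (\<lambda>i\<in>I. if i \<in> I then f i else 0)" using that by (intro ext_D) auto
    show ?thesis by (subst eq) (rule mem)
  qed
  then have "D.span ?S = carrier D" using D.subspaceD(1)[OF sp] by auto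
  then show ?thesis using operator_space_D by (simp add: semisimple_rep_def)
qed

end

lemma A_rep_scalar_sum:
  assumes "finite I"
    and "\<And>i. i \<in> I \<Longrightarrow> (c i As = 1 \<and> c i Ay2 = c i Ay1 + 1 \<or> c i As = - 1 \<and> c i Ay2 = c i Ay1 - 1) \<and> c i Ae = 0"
  shows "A_rep (direct_sum_rep I (\<lambda>i. scalar_rep (c i)))"
proof -
  interpret scalar_sum I c by standard (rule assms(1))
  show ?thesis
    unfolding A_rep_def Let_def
    using operator_space_D assms(2)
    by (intro conjI ballI ext_D) (auto simp: minus_D uminus_D distrib_right left_diff_distrib dest!: assms(2))
qed

section \<open>The extension\<close>

context based_space begin

lemma coord_comb:
  assumes J: "finite J" "inj_on u J" "u ` J \<subseteq> B"
  shows "(\<Oplus>j\<in>J. h j \<odot> u j) \<in> carrier V"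
    and "j \<in> J \<Longrightarrow> coord (u j) (\<Oplus>j\<in>J. h j \<odot> u j) = h j"
    and "b \<notin> u ` J \<Longrightarrow> coord b (\<Oplus>j\<in>J. h j \<odot> u j) = 0"
proof -
  have u: "u i \<in> B" if "i \<in> J" for i using that J by auto
  have Pi: "(\<lambda>j. h j \<odot> u j) \<in> J \<rightarrow> carrier V" using u by auto
  show "(\<Oplus>j\<in>J. h j \<odot> u j) \<in> carrier V" using Pi by (rule M.finsum_closed)
  have c: "coord b (\<Oplus>j\<in>J. h j \<odot> u j) = (\<Sum>i\<in>J. if b = u i then h i else 0)" for b
    unfolding coord_finsum[OF Pi] using u by (intro sum.cong) (auto simp: coord_basis)
  show "coord (u j) (\<Oplus>j\<in>J. h j \<odot> u j) = h j" if j: "j \<in> J"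
  proof -
    have "(\<Sum>i\<in>J. if u j = u i then h i else 0) = (\<Sum>i\<in>J. if i = j then h i else 0)"
      using J j by (intro sum.cong) (auto simp: inj_on_def)
    then show ?thesis using J j by (simp add: c)
  qed
  show "coord b (\<Oplus>j\<in>J. h j \<odot> u j) = 0" if "b \<notin> u ` J"
    unfolding c using that by (intro sum.neutral) auto
qed

end

locale split_module = calibrated_A_module V B \<alpha> \<beta>
  for V :: "('v, A_gen) rep" (structure) and B \<alpha> \<beta> +
  assumes K_eq_N: "K = N" and B_eq: "B = B\<^sub>N \<union> B\<^sub>P"
begin

lemma s_N: "x \<in> N \<Longrightarrow> s x = \<ominus> x"
  using K_eq_N by (auto simp: K_def)

lemma coord_s_P:
  assumes "x \<in> carrier V" and b: "b \<in> B\<^sub>P"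
  shows "coord b (s x) = coord b x"
  using assms(1)
proof (induction rule: basis_induct)
  case (basis b')
  have bN: "b \<notin> B\<^sub>N" using b B\<^sub>N_B\<^sub>P by blast
  show ?case
  proof (cases "b' \<in> B\<^sub>N")
    case True
    then have "b' \<in> N" using basis mem_cspan N_eq by simp
    then show ?thesis using basis s_N coord_N[OF _ bN, of b'] by simp
  next
    case False
    then have "b' \<in> P" using basis B_eq mem_cspan P_eq by blast
    then have "s b' \<ominus> b' \<in> N" using s_P by (auto simp: K_def)
    then have "coord b (s b' \<ominus> b') = 0" using coord_N bN by blast
    then show ?thesis using basis by simp
  qed
qed auto

lemma coord_e_P: "x \<in> carrier V \<Longrightarrow> b \<in> B\<^sub>P \<Longrightarrow> coord b (e x) = 0"
  using coord_N[of "e x" b] e_K K_eq_N B\<^sub>N_B\<^sub>P(3) by blast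

lemma extension:
  assumes e: "\<exists>v\<in>carrier V. e v \<noteq> \<zero>"
  shows "\<exists>k l a b.
     let K = direct_sum_rep {1..k} (\<lambda>i. V_minus (a i));
         Q = direct_sum_rep {1..l} (\<lambda>j. V_plus (b j - 1))
     in k \<ge> 1 \<and> l \<ge> 1 \<and> has_dim V (k + l) \<and>
        acts_by_diag V Ay1 (k + l) (\<lambda>i. if i \<le> k then a i else b (i - k) - 1) \<and>
        A_rep K \<and> semisimple_rep K \<and> A_rep Q \<and> semisimple_rep Q \<and>
        (\<exists>\<iota> \<pi>. short_exact K \<iota> V \<pi> Q)"
proof -
  define k where "k = card B\<^sub>N"
  define l where "l = card B\<^sub>P"
  have fin: "finite B\<^sub>N" "finite B\<^sub>P" using finite_B B\<^sub>N_B\<^sub>P by (auto intro: finite_subset)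
  obtain f where f: "bij_betw f {1..k} B\<^sub>N"
    using ex_bij_betw_nat_finite_1[OF fin(1)] k_def by auto
  obtain g where g: "bij_betw g {1..l} B\<^sub>P"
    using ex_bij_betw_nat_finite_1[OF fin(2)] l_def by auto
  define v where "v i = (if i \<le> k then f i else g (i - k))" for i
  define a where "a i = \<alpha> (f i)" for i
  define b where "b j = \<alpha> (g j) + 1" for j
  have f_inj: "inj_on f {1..k}" and f_im: "f ` {1..k} = B\<^sub>N" using f by (auto simp: bij_betw_def)
  have g_inj: "inj_on g {1..l}" and g_im: "g ` {1..l} = B\<^sub>P" using g by (auto simp: bij_betw_def)
  have f_mem: "f i \<in> B\<^sub>N" if "i \<in> {1..k}" for i using f_im that by blast
  have g_mem: "g i \<in> B\<^sub>P" if "i \<in> {1..l}" for i using g_im that by blast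
  have v1: "bij_betw v {1..k} B\<^sub>N"
    using f by (rule bij_betw_cong[THEN iffD1, rotated]) (auto simp: v_def)
  have shift: "bij_betw (\<lambda>i. i - k) {k+1..k+l} {1..l}"
    by (rule bij_betwI[of _ _ _ "\<lambda>i. i + k"]) auto
  have v2: "bij_betw v {k+1..k+l} B\<^sub>P"
    using bij_betw_trans[OF shift g]
    by (rule bij_betw_cong[THEN iffD1, rotated]) (auto simp: v_def)
  have "{1..k} \<union> {k+1..k+l} = {1..k+l}" by auto
  then have v: "bij_betw v {1..k+l} B"
    using bij_betw_combine[OF v1 v2] B\<^sub>N_B\<^sub>P B_eq by simp
  have cardB: "card B = k + l"
    using B_eq card_Un_disjoint[OF fin B\<^sub>N_B\<^sub>P(3)] by (simp add: k_def l_def)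
  have dim: "has_dim V (k + l)"
    using dim_basis[OF finite_B is_basis] finite_B is_basis cardB
    unfolding has_dim_def fin_dim_def basis_def by (intro conjI exI[of _ B]) auto
  have diag: "acts_by_diag V Ay1 (k + l) (\<lambda>i. if i \<le> k then a i else b (i - k) - 1)"
    unfolding acts_by_diag_def
  proof (intro exI[of _ v] conjI ballI)
    show "inj_on v {1..k+l}" "basis (v ` {1..k+l})"
      using v is_basis by (simp_all add: bij_betw_def)
    fix i assume "i \<in> {1..k+l}"
    then have "v i \<in> B" using v by (auto simp: bij_betw_def)
    then show "y1 (v i) = (if i \<le> k then a i else b (i - k) - 1) \<odot> v i"
      by (simp add: y1_basis) (simp add: v_def a_def b_def)
  qed
  obtain x where x: "x \<in> carrier V" "e x \<noteq> \<zero>" using e by blast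
  have "B\<^sub>N \<noteq> {}"
  proof
    assume "B\<^sub>N = {}"
    then have "N = {\<zero>}" unfolding N_eq using coord_eq_0_iff by (auto simp: cspan_def)
    then show False using e_K[OF x(1)] x(2) K_eq_N by simp
  qed
  then have k: "k \<ge> 1" using fin by (simp add: k_def Suc_leI card_gt_0_iff)
  have "B\<^sub>P \<noteq> {}"
  proof
    assume "B\<^sub>P = {}"
    then have "B\<^sub>N = B" using B_eq by simp
    then have "x \<in> N" unfolding N_eq using x by (auto simp: cspan_def)
    then show False using e_N x by blast
  qed
  then have l: "l \<ge> 1" using fin by (simp add: l_def Suc_leI card_gt_0_iff)
  define J where "J = {1..k}"
  define L where "L = {1..l}"
  have finJ: "finite J" and finL: "finite L" by (auto simp: J_def L_def)
  note f_inj = f_inj[folded J_def] and f_im = f_im[folded J_def] and f_mem = f_mem[folded J_def]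
  note g_inj = g_inj[folded L_def] and g_im = g_im[folded L_def] and g_mem = g_mem[folded L_def]
  define cK :: "nat \<Rightarrow> A_gen \<Rightarrow> complex" where
    "cK i = (\<lambda>g. case g of As \<Rightarrow> - 1 | Ay1 \<Rightarrow> a i | Ay2 \<Rightarrow> a i - 1 | Ae \<Rightarrow> 0)" for i
  define cQ :: "nat \<Rightarrow> A_gen \<Rightarrow> complex" where
    "cQ j = (\<lambda>g. case g of As \<Rightarrow> 1 | Ay1 \<Rightarrow> b j - 1 | Ay2 \<Rightarrow> b j - 1 + 1 | Ae \<Rightarrow> 0)" for j
  have cK: "cK i As = - 1" "cK i Ay1 = a i" "cK i Ay2 = a i - 1" "cK i Ae = 0" for i
    by (simp_all add: cK_def)
  have cQ: "cQ j As = 1" "cQ j Ay1 = b j - 1" "cQ j Ay2 = b j" "cQ j Ae = 0" for j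
    by (simp_all add: cQ_def)
  let ?K = "direct_sum_rep J (\<lambda>i. V_minus (a i))"
  let ?Q = "direct_sum_rep L (\<lambda>j. V_plus (b j - 1))"
  have K: "?K = direct_sum_rep J (\<lambda>i. scalar_rep (cK i))"
    by (simp add: V_minus_def cK_def)
  have Q: "?Q = direct_sum_rep L (\<lambda>j. scalar_rep (cQ j))"
    by (simp add: V_plus_def cQ_def)
  interpret K: scalar_sum "J" cK by standard (rule finJ)
  interpret Q: scalar_sum "L" cQ by standard (rule finL)
  have "A_rep K.D" "A_rep Q.D"
    by (rule A_rep_scalar_sum[OF finJ], simp add: cK)
      (rule A_rep_scalar_sum[OF finL], simp add: cQ)
  then have KQ: "A_rep ?K" "A_rep ?Q" "semisimple_rep ?K" "semisimple_rep ?Q"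
    using K.semisimple_D Q.semisimple_D unfolding K Q by blast+
  define \<iota> where "\<iota> h = (\<Oplus>i\<in>J. h i \<odot> f i)" for h
  define \<pi> where "\<pi> x = (\<lambda>j\<in>L. coord (g j) x)" for x
  note f_comb = coord_comb[OF finJ f_inj, unfolded f_im, OF B\<^sub>N_B\<^sub>P(1), folded \<iota>_def]
  have \<iota>_N: "\<iota> h \<in> N" for h
    unfolding N_eq cspan_def using f_comb(1,3) by simp
  have N_C: "x \<in> N \<Longrightarrow> x \<in> carrier V" for x by (simp add: N_def)
  have N_ext: "x = y" if "x \<in> N" "y \<in> N" "\<And>i. i \<in> J \<Longrightarrow> coord (f i) x = coord (f i) y" for x y
  proof (rule coord_ext)
    fix b' assume "b' \<in> B"
    show "coord b' x = coord b' y"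
    proof (cases "b' \<in> B\<^sub>N")
      case True
      then obtain i where "i \<in> J" "b' = f i" using f_im by blast
      then show ?thesis using that(3) by blast
    qed (simp add: coord_N that)
  qed (use that N_C in auto)
  have hom_\<iota>: "rep_hom ?K V \<iota>"
    unfolding rep_hom_def K
  proof (intro conjI allI ballI)
    show "linear_map class_ring K.D V \<iota>"
    proof (rule linear_map_classI)
      fix h h' assume "h \<in> carrier K.D" "h' \<in> carrier K.D"
      show "\<iota> (h \<oplus>\<^bsub>K.D\<^esub> h') = \<iota> h \<oplus> \<iota> h'"
        by (rule N_ext) (use subspaceD(3)[OF subspace_N] \<iota>_N N_C in \<open>auto simp: f_comb(2)\<close>)
    next
      fix c h assume "h \<in> carrier K.D"
      show "\<iota> (c \<odot>\<^bsub>K.D\<^esub> h) = c \<odot> \<iota> h"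
        by (rule N_ext) (use subspaceD(4)[OF subspace_N] \<iota>_N N_C in \<open>auto simp: f_comb(2)\<close>)
    qed (use K.vectorspace_D vectorspace_axioms f_comb(1) in auto)
    fix x h
    note [simp] = N_C[OF \<iota>_N] f_comb(2)
    have "act V x (\<iota> h) \<in> N"
      using \<iota>_N[of h] y1_N y2_N e_N s_N subspaceD(2,5)[OF subspace_N] by (cases x) auto
    then show "\<iota> (act K.D x h) = act V x (\<iota> h)"
    proof (rule N_ext[OF \<iota>_N])
      fix i assume i: "i \<in> J"
      then show "coord (f i) (\<iota> (act K.D x h)) = coord (f i) (act V x (\<iota> h))"
        using s_N[OF \<iota>_N[of h]] e_N[OF \<iota>_N[of h]] y2_of_N[OF \<iota>_N[of h]]
        by (cases x) (simp_all add: cK a_def coord_y1 algebra_simps)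
    qed
  qed
  have hom_\<pi>: "rep_hom V ?Q \<pi>"
    unfolding rep_hom_def Q
  proof (intro conjI allI ballI)
    show "linear_map class_ring V Q.D \<pi>"
      by (rule linear_map_classI)
        (use Q.vectorspace_D vectorspace_axioms in \<open>auto simp: \<pi>_def intro!: Q.ext_D\<close>)
    fix x u assume u: "u \<in> carrier V"
    show "\<pi> (act V x u) = act Q.D x (\<pi> u)"
    proof (rule Q.ext_D)
      fix j assume j: "j \<in> L"
      have "\<beta> (g j) = \<alpha> (g j) + 1"
        using g_mem[OF j] by (auto simp: B\<^sub>P_def algebra_simps)
      then show "\<pi> (act V x u) j = act Q.D x (\<pi> u) j"
        using j u g_mem[OF j]
        by (cases x) (simp_all add: \<pi>_def cQ coord_s_P coord_e_P coord_y1 coord_y2 b_def)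
    qed (auto simp: \<pi>_def)
  qed
  have "inj_on \<iota> (carrier ?K)"
    unfolding K
  proof (rule inj_onI)
    fix h h' assume h: "h \<in> carrier K.D" "h' \<in> carrier K.D" "\<iota> h = \<iota> h'"
    show "h = h'"
      by (rule K.ext_D) (use h f_comb(2)[of _ h] f_comb(2)[of _ h'] in auto)
  qed
  moreover have "\<pi> ` carrier V = carrier ?Q"
    unfolding Q
  proof (intro Set.equalityI subsetI)
    fix h assume h: "h \<in> carrier Q.D"
    note g_comb = coord_comb[OF finL g_inj, where h = h, unfolded g_im, OF B\<^sub>N_B\<^sub>P(2)]
    have "\<pi> (\<Oplus>j\<in>L. h j \<odot> g j) = h"
      by (rule Q.ext_D) (use h g_comb(2) in \<open>auto simp: \<pi>_def\<close>)
    then show "h \<in> \<pi> ` carrier V" using g_comb(1) by (metis image_eqI)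
  qed (auto simp: \<pi>_def)
  moreover have "\<iota> ` carrier ?K = {v \<in> carrier V. \<pi> v = \<zero>\<^bsub>?Q\<^esub>}"
    unfolding K Q
  proof (intro Set.equalityI subsetI)
    fix x assume "x \<in> \<iota> ` carrier K.D"
    then have xN: "x \<in> N" using \<iota>_N by auto
    have "\<pi> x = \<zero>\<^bsub>Q.D\<^esub>"
    proof (rule Q.ext_D)
      fix j assume j: "j \<in> L"
      then have "coord (g j) x = 0" using coord_N[OF xN] g_mem[OF j] B\<^sub>N_B\<^sub>P(3) by blast
      then show "\<pi> x j = \<zero>\<^bsub>Q.D\<^esub> j" using j by (simp add: \<pi>_def)
    qed (auto simp: \<pi>_def)
    then show "x \<in> {v \<in> carrier V. \<pi> v = \<zero>\<^bsub>Q.D\<^esub>}" using N_C[OF xN] by simp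
  next
    fix x assume "x \<in> {v \<in> carrier V. \<pi> v = \<zero>\<^bsub>Q.D\<^esub>}"
    then have x: "x \<in> carrier V" "\<pi> x = \<zero>\<^bsub>Q.D\<^esub>" by auto
    have "coord b' x = 0" if b': "b' \<in> B - B\<^sub>N" for b'
    proof -
      have "b' \<in> g ` L" using b' B_eq g_im by blast
      then obtain j where "j \<in> L" "b' = g j" by blast
      then show ?thesis using fun_cong[OF x(2), of j] by (simp add: \<pi>_def)
    qed
    then have xN: "x \<in> N" using x(1) by (simp add: N_eq cspan_def)
    have "\<iota> (\<lambda>i\<in>J. coord (f i) x) = x"
      by (rule N_ext[OF \<iota>_N xN]) (simp add: f_comb(2))
    then show "x \<in> \<iota> ` carrier K.D" by (intro image_eqI[of _ _ "\<lambda>i\<in>J. coord (f i) x"]) auto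
  qed
  ultimately have "short_exact ?K \<iota> V \<pi> ?Q"
    using hom_\<iota> hom_\<pi> unfolding short_exact_def by blast
  then show ?thesis
    unfolding Let_def using k l dim diag KQ unfolding J_def L_def
    by (intro exI[of _ k] exI[of _ l] exI[of _ a] exI[of _ b] conjI) auto
qed

end

section \<open>Composition factors\<close>

lemma simple_rep_dim1:
  fixes F :: "('v, 'g) rep"
  assumes F: "simple_rep F" and x: "x \<in> carrier F" "x \<noteq> \<zero>\<^bsub>F\<^esub>"
    and eigen: "\<And>g. \<exists>c. act F g x = c \<odot>\<^bsub>F\<^esub> x"
  shows "has_dim F 1"
proof -
  have vs: "vectorspace class_ring F" and lin: "linear_map class_ring F F (act F g)" for g
    using F by (auto simp: simple_rep_def operator_space_def)
  interpret cspace F using vs by (simp add: cspace_def)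
  have sub: "VectorSpace.subspace class_ring (span {x}) F" by (rule span_is_subspace) (use x in simp)
  have spanE: "\<exists>c. w = c \<odot>\<^bsub>F\<^esub> x" if w: "w \<in> span {x}" for w
  proof -
    obtain c where "lincomb c {x} = w" using finite_in_span[of "{x}" w] w x by auto
    then show ?thesis using x by (auto simp: lincomb_def)
  qed
  have "x \<in> span {x}" using in_own_span[of "{x}"] x by auto
  have "subrep (span {x}) F"
    unfolding subrep_def
  proof (intro conjI sub allI ballI)
    fix g w assume "w \<in> span {x}"
    then obtain c where w: "w = c \<odot>\<^bsub>F\<^esub> x" using spanE by blast
    obtain d where "act F g x = d \<odot>\<^bsub>F\<^esub> x" using eigen by blast
    then have "act F g w = c \<odot>\<^bsub>F\<^esub> (d \<odot>\<^bsub>F\<^esub> x)"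
      using linear_map.T_smult[OF lin, of c x g] x w by simp
    then show "act F g w \<in> span {x}" using subspaceD(4)[OF sub] \<open>x \<in> span {x}\<close> by simp
  qed
  then have "gen_set {x}"
    using F \<open>x \<in> span {x}\<close> x unfolding simple_rep_def by blast
  then show ?thesis
    using dim1I[of x] x unfolding has_dim_def fin_dim_def by (intro conjI exI[of _ "{x}"]) auto
qed

locale quotient_by = cspace M for M :: "('v, 'g) rep" (structure) +
  fixes U U' :: "'v set"
  assumes op: "operator_space M" and U: "subrep U M" and U': "subrep U' M" and le: "U \<subseteq> U'"
begin

definition F where "F = quotient_rep (M\<lparr>carrier := U'\<rparr>) U"
definition p where "p a = U +>\<^bsub>M\<^esub> a"

lemma lin: "linear_map class_ring M M (act M g)"
  using op by (auto simp: operator_space_def)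

lemma subU: "VectorSpace.subspace class_ring U M" and subU': "VectorSpace.subspace class_ring U' M"
  using U U' by (auto simp: subrep_def)

lemma memU: "u \<in> U \<Longrightarrow> u \<in> carrier M" and memU': "u \<in> U' \<Longrightarrow> u \<in> carrier M"
  using subspaceD(1)[OF subU] subspaceD(1)[OF subU'] by auto

lemma mem_p: "x \<in> p a \<longleftrightarrow> (\<exists>u\<in>U. x = u \<oplus> a)"
  by (auto simp: p_def a_r_coset_def')

lemma p_image: "p a = (\<lambda>u. u \<oplus> a) ` U"
  by (auto simp: mem_p)

lemma p_eq_iff:
  assumes "a \<in> carrier M" "b \<in> carrier M"
  shows "p a = p b \<longleftrightarrow> a \<ominus> b \<in> U"
proof
  assume "p a = p b"
  moreover have "a \<in> p a" unfolding mem_p using assms subspaceD(2)[OF subU] by (intro bexI[of _ \<zero>]) auto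
  ultimately obtain u where "u \<in> U" "a = u \<oplus> b" by (auto simp: mem_p)
  then show "a \<ominus> b \<in> U" using assms memU by (simp add: a_minus_def M.a_assoc M.r_neg)
next
  assume ab: "a \<ominus> b \<in> U"
  have *: "p x \<subseteq> p y" if "x \<ominus> y \<in> U" "x \<in> carrier M" "y \<in> carrier M" for x y
  proof
    fix w assume "w \<in> p x"
    then obtain u where u: "u \<in> U" "w = u \<oplus> x" by (auto simp: mem_p)
    have "w = (u \<oplus> (x \<ominus> y)) \<oplus> y"
      using that u memU by (simp add: a_minus_def M.a_assoc M.l_neg)
    then show "w \<in> p y" unfolding mem_p using subspaceD(3)[OF subU u(1) that(1)] by blast
  qed
  have "\<ominus> (a \<ominus> b) = b \<ominus> a" using assms by (simp add: a_minus_def M.minus_add M.a_comm)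
  then have "b \<ominus> a \<in> U" using subspaceD(5)[OF subU ab] by simp
  then show "p a = p b" using * ab assms by (intro Set.equalityI) auto
qed

lemma carrier_F: "carrier F = p ` U'"
  by (auto simp: F_def quotient_rep_def A_RCOSETS_def RCOSETS_def p_def a_r_coset_def r_coset_def)

lemma zero_F: "\<zero>\<^bsub>F\<^esub> = p \<zero>"
  using memU by (auto simp: F_def quotient_rep_def mem_p)

lemma p_add: "a \<in> U' \<Longrightarrow> b \<in> U' \<Longrightarrow> p a \<oplus>\<^bsub>F\<^esub> p b = p (a \<oplus> b)"
proof (rule Set.set_eqI)
  fix x assume ab: "a \<in> U'" "b \<in> U'"
  have "p a \<oplus>\<^bsub>F\<^esub> p b = (\<Union>h\<in>p a. \<Union>k\<in>p b. {h \<oplus> k})"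
    by (simp add: F_def quotient_rep_def set_add_def')
  then have "x \<in> p a \<oplus>\<^bsub>F\<^esub> p b \<longleftrightarrow> (\<exists>u\<in>U. \<exists>v\<in>U. x = (u \<oplus> a) \<oplus> (v \<oplus> b))"
    by (simp add: p_image)
  also have "\<dots> \<longleftrightarrow> (\<exists>u\<in>U. \<exists>v\<in>U. x = (u \<oplus> v) \<oplus> (a \<oplus> b))"
    using ab memU memU' by (intro bex_cong refl) (auto simp: M.a_ac)
  also have "\<dots> \<longleftrightarrow> x \<in> p (a \<oplus> b)"
  proof
    assume "\<exists>u\<in>U. \<exists>v\<in>U. x = (u \<oplus> v) \<oplus> (a \<oplus> b)"
    then show "x \<in> p (a \<oplus> b)" using subspaceD(3)[OF subU] unfolding mem_p by blast
  next
    assume "x \<in> p (a \<oplus> b)"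
    then obtain u where "u \<in> U" "x = u \<oplus> (a \<oplus> b)" unfolding mem_p by blast
    then show "\<exists>u\<in>U. \<exists>v\<in>U. x = (u \<oplus> v) \<oplus> (a \<oplus> b)"
      using memU subspaceD(2)[OF subU] by (intro bexI[of _ u] bexI[of _ \<zero>]) auto
  qed
  finally show "x \<in> p a \<oplus>\<^bsub>F\<^esub> p b \<longleftrightarrow> x \<in> p (a \<oplus> b)" .
qed

lemma UN_p:
  assumes "\<And>x. x \<in> p a \<Longrightarrow> p (f x) = p b" "a \<in> carrier M"
  shows "(\<Union>x\<in>p a. U +>\<^bsub>M\<lparr>carrier := U'\<rparr>\<^esub> f x) = p b"
proof -
  have "a \<in> p a" unfolding mem_p using assms(2) subspaceD(2)[OF subU] by (intro bexI[of _ \<zero>]) auto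
  moreover have "U +>\<^bsub>M\<lparr>carrier := U'\<rparr>\<^esub> f x = p (f x)" for x by (simp add: p_def a_r_coset_def')
  ultimately show ?thesis using assms(1) by auto
qed

lemma mem_p_diff: "x \<in> p a \<Longrightarrow> a \<in> carrier M \<Longrightarrow> x \<in> carrier M \<and> x \<ominus> a \<in> U"
  using memU by (auto simp: mem_p a_minus_def M.a_assoc M.r_neg)

lemma p_smult:
  assumes a: "a \<in> U'" shows "c \<odot>\<^bsub>F\<^esub> p a = p (c \<odot> a)"
proof -
  have aC: "a \<in> carrier M" using a memU' by simp
  have "p (c \<odot> x) = p (c \<odot> a)" if "x \<in> p a" for x
  proof -
    have x: "x \<in> carrier M" "x \<ominus> a \<in> U" using mem_p_diff[OF that aC] by auto
    have "c \<odot> x \<ominus> c \<odot> a = c \<odot> (x \<ominus> a)"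
      using x aC by (simp add: a_minus_def smult_add_right a_inv_smult flip: smult_mult)
    then show ?thesis using subspaceD(4)[OF subU x(2), of c] x aC by (simp add: p_eq_iff)
  qed
  then show ?thesis using UN_p[of a "\<lambda>x. c \<odot> x"] aC by (simp add: F_def quotient_rep_def)
qed

lemma p_act:
  assumes a: "a \<in> U'" shows "act F g (p a) = p (act M g a)"
proof -
  have aC: "a \<in> carrier M" using a memU' by simp
  have "p (act M g x) = p (act M g a)" if "x \<in> p a" for x
  proof -
    have x: "x \<in> carrier M" "x \<ominus> a \<in> U" using mem_p_diff[OF that aC] by auto
    have "act M g x \<ominus> act M g a = act M g (x \<ominus> a)"
      using linear_map.T_minus[OF lin x(1) aC] by simp
    moreover have "act M g (x \<ominus> a) \<in> U" using U x(2) by (simp add: subrep_def)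
    ultimately show ?thesis
      using linear_map.T_im[OF lin] x aC by (simp add: p_eq_iff)
  qed
  then show ?thesis using UN_p[of a "act M g"] aC by (simp add: F_def quotient_rep_def)
qed

lemma act_U': "a \<in> U' \<Longrightarrow> act M g a \<in> U'"
  using U' by (simp add: subrep_def)

lemma p_eq_zero_iff: "a \<in> U' \<Longrightarrow> p a = \<zero>\<^bsub>F\<^esub> \<longleftrightarrow> a \<in> U"
  using memU' p_eq_iff[of a \<zero>] by (simp add: zero_F a_minus_def a_inv_smult)

lemma subrep_image:
  assumes "vectorspace class_ring F" "subrep X M"
  shows "subrep (p ` (U' \<inter> X)) F"
proof -
  interpret F: cspace F using assms(1) by (simp add: cspace_def)
  have X: "VectorSpace.subspace class_ring X M" "\<And>g x. x \<in> X \<Longrightarrow> act M g x \<in> X"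
    using assms(2) by (auto simp: subrep_def)
  show ?thesis
    unfolding subrep_def
  proof (intro conjI allI ballI F.subspaceI)
    show "p ` (U' \<inter> X) \<subseteq> carrier F" by (auto simp: carrier_F)
    show "\<zero>\<^bsub>F\<^esub> \<in> p ` (U' \<inter> X)"
      using subspaceD(2)[OF subU'] subspaceD(2)[OF X(1)] by (auto simp: zero_F)
    show "x \<oplus>\<^bsub>F\<^esub> y \<in> p ` (U' \<inter> X)" if "x \<in> p ` (U' \<inter> X)" "y \<in> p ` (U' \<inter> X)" for x y
      using that subspaceD(3)[OF subU'] subspaceD(3)[OF X(1)] by (auto simp: p_add)
    show "c \<odot>\<^bsub>F\<^esub> x \<in> p ` (U' \<inter> X)" if "x \<in> p ` (U' \<inter> X)" for c x
      using that subspaceD(4)[OF subU'] subspaceD(4)[OF X(1)] by (auto simp: p_smult)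
    show "act F g x \<in> p ` (U' \<inter> X)" if "x \<in> p ` (U' \<inter> X)" for g x
      using that act_U' X(2) by (auto simp: p_act)
  qed
qed

end

context split_module begin

lemma composition_factor_dim1:
  assumes "composition_factor V F" shows "has_dim F 1"
proof -
  obtain Us i where Us: "composition_series V Us" "Suc i < length Us" "F = series_factor V Us i"
    using assms by (auto simp: composition_factor_def)
  define U where "U = Us ! i"
  define U' where "U' = Us ! Suc i"
  have sub: "subrep U V" "subrep U' V" "U \<subseteq> U'"
    and simple: "simple_rep (quotient_rep (V\<lparr>carrier := U'\<rparr>) U)"
    using Us unfolding composition_series_def series_factor_def U_def U'_def by auto
  have op: "operator_space V" using A_rep unfolding A_rep_def by blast
  interpret Q: quotient_by V U U' by standard (use sub op in auto)
  have F: "F = Q.F" using Us(3) unfolding series_factor_def U_def[symmetric] U'_def[symmetric] Q.F_def .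
  have simpleF: "simple_rep Q.F" using simple by (simp add: Q.F_def)
  then have vs: "vectorspace class_ring Q.F" by (simp add: simple_rep_def operator_space_def)
  interpret F: cspace Q.F using vs by (simp add: cspace_def)
  let ?supp = "\<lambda>x. {b \<in> B. coord b x \<noteq> 0}"
  have "U' - U \<noteq> {}"
  proof
    assume "U' - U = {}"
    then have "carrier Q.F = {\<zero>\<^bsub>Q.F\<^esub>}"
      using Q.p_eq_zero_iff F.M.zero_closed unfolding Q.carrier_F by blast
    then show False using simpleF by (simp add: simple_rep_def)
  qed
  then obtain x where x: "x \<in> U' - U" and min: "\<And>x'. x' \<in> U' - U \<Longrightarrow> card (?supp x) \<le> card (?supp x')"
    using ex_has_least_nat[of "\<lambda>x. x \<in> U' - U" _ "\<lambda>x. card (?supp x)"] by blast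
  have xC: "x \<in> carrier V" and xU: "x \<in> U'" using x Q.memU' by auto
  have px: "Q.p x \<noteq> \<zero>\<^bsub>Q.F\<^esub>" using x Q.p_eq_zero_iff by simp
  have "x \<noteq> \<zero>" using x subspaceD(2)[OF Q.subU] by auto
  then obtain b where b: "b \<in> B" "coord b x \<noteq> 0" using coord_eq_0_iff[OF xC] by blast
  define x' where "x' = y1 x \<ominus> \<alpha> b \<odot> x"
  have x': "x' \<in> U'" unfolding x'_def
    using Q.act_U'[OF xU] subspaceD(4,6)[OF Q.subU'] xU by auto
  have "?supp x' \<subset> ?supp x"
    using b xC by (auto simp: x'_def coord_y1)
  then have "card (?supp x') < card (?supp x)" using finite_B by (intro psubset_card_mono) auto
  then have "x' \<in> U" using min[of x'] x' by force
  then have y1x: "act Q.F Ay1 (Q.p x) = \<alpha> b \<odot>\<^bsub>Q.F\<^esub> Q.p x"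
    using xU xC by (simp add: Q.p_act Q.p_smult Q.p_eq_iff x'_def)
  let ?X = "Q.p ` (U' \<inter> N)"
  have "subrep ?X Q.F" by (rule Q.subrep_image[OF vs subrep_K[unfolded K_eq_N]])
  then have "?X = {\<zero>\<^bsub>Q.F\<^esub>} \<or> ?X = carrier Q.F" using simpleF by (simp add: simple_rep_def)
  then have "\<exists>c. act Q.F g (Q.p x) = c \<odot>\<^bsub>Q.F\<^esub> Q.p x" for g
  proof
    assume X0: "?X = {\<zero>\<^bsub>Q.F\<^esub>}"
    have NU: "n \<in> U" if "n \<in> U'" "n \<in> N" for n
      using X0 that Q.p_eq_zero_iff[OF that(1)] by blast
    have inN: "w \<in> N" if "w \<in> carrier V" "\<And>b. b \<in> B\<^sub>P \<Longrightarrow> coord b w = 0" for w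
      unfolding N_eq cspan_def using that B_eq by blast
    have 1: "s x \<ominus> x \<in> U"
      by (rule NU[OF subspaceD(6)[OF Q.subU' Q.act_U' xU] inN]) (use xU xC in \<open>auto simp: coord_s_P\<close>)
    have 2: "e x \<in> U"
      by (rule NU[OF Q.act_U' inN]) (use xU xC in \<open>auto simp: coord_e_P\<close>)
    have 3: "y2 x \<ominus> (y1 x \<oplus> x) \<in> U"
    proof (rule NU[OF subspaceD(6)[OF Q.subU' Q.act_U' subspaceD(3)[OF Q.subU' Q.act_U']] inN])
      fix b assume "b \<in> B\<^sub>P"
      then have "\<beta> b = \<alpha> b + 1" by (auto simp: B\<^sub>P_def algebra_simps)
      then show "coord b (y2 x \<ominus> (y1 x \<oplus> x)) = 0"
        using xC by (simp add: coord_y1 coord_y2 algebra_simps)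
    qed (use xU xC in auto)
    show ?thesis
    proof (cases g)
      case As
      have "act Q.F As (Q.p x) = 1 \<odot>\<^bsub>Q.F\<^esub> Q.p x"
        using 1 xU xC by (simp add: Q.p_act Q.p_smult Q.p_eq_iff)
      then show ?thesis using As by blast
    next
      case Ay2
      have "act Q.F Ay2 (Q.p x) = Q.p (y1 x) \<oplus>\<^bsub>Q.F\<^esub> Q.p x"
        using 3 xU xC Q.act_U' by (simp add: Q.p_act Q.p_add Q.p_eq_iff)
      also have "\<dots> = (\<alpha> b + 1) \<odot>\<^bsub>Q.F\<^esub> Q.p x"
        using y1x xU F.smult_add_left[of "Q.p x" "\<alpha> b" 1] F.smult_1[of "Q.p x"]
        by (simp add: Q.p_act Q.carrier_F)
      finally show ?thesis using Ay2 by blast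
    next
      case Ae
      have "act Q.F Ae (Q.p x) = 0 \<odot>\<^bsub>Q.F\<^esub> Q.p x"
        using 2 xU xC by (simp add: Q.p_act Q.p_smult Q.p_eq_iff a_minus_def uminus_zero)
      then show ?thesis using Ae by blast
    qed (use y1x in blast)
  next
    assume "?X = carrier Q.F"
    then obtain n where n: "n \<in> U'" "n \<in> N" "Q.p x = Q.p n"
      using xU unfolding Q.carrier_F by blast
    have nC: "n \<in> carrier V" using n Q.memU' by auto
    have pn: "Q.p n \<in> carrier Q.F" using n Q.carrier_F by blast
    have neg: "Q.p (\<ominus> n) = (- 1) \<odot>\<^bsub>Q.F\<^esub> Q.p n"
      using n nC by (simp add: Q.p_smult a_inv_smult)
    show ?thesis
    proof (cases g)
      case As
      have "act Q.F As (Q.p n) = (- 1) \<odot>\<^bsub>Q.F\<^esub> Q.p n"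
        using n s_N[OF n(2)] neg by (simp add: Q.p_act)
      then show ?thesis using As n(3) by auto
    next
      case Ay2
      have "act Q.F Ay2 (Q.p n) = Q.p (y1 n \<oplus> \<ominus> n)"
        using n by (simp add: Q.p_act y2_of_N a_minus_def)
      also have "\<dots> = Q.p (y1 n) \<oplus>\<^bsub>Q.F\<^esub> Q.p (\<ominus> n)"
        using n Q.act_U' subspaceD(5)[OF Q.subU'] by (simp add: Q.p_add)
      also have "\<dots> = (\<alpha> b + - 1) \<odot>\<^bsub>Q.F\<^esub> Q.p n"
        using y1x n F.smult_add_left[OF pn, of "\<alpha> b" "- 1"] by (simp add: Q.p_act neg)
      finally show ?thesis using Ay2 n(3) by auto
    next
      case Ae
      have "act Q.F Ae (Q.p n) = 0 \<odot>\<^bsub>Q.F\<^esub> Q.p n"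
        using n nC e_N[OF n(2)] by (simp add: Q.p_act Q.p_smult)
      then show ?thesis using Ae n(3) by auto
    qed (use y1x in blast)
  qed
  moreover have "Q.p x \<in> carrier Q.F" using xU Q.carrier_F by blast
  ultimately show ?thesis unfolding F by (intro simple_rep_dim1[OF simpleF _ px])
qed

end

section \<open>Simple representations\<close>

context A_module begin

lemma e_zero_of_simple:
  assumes "simple_rep V" "x \<in> carrier V" shows "e x = \<zero>"
proof -
  have "K = {\<zero>} \<or> K = carrier V"
    using assms(1) subrep_K by (simp add: simple_rep_def)
  then show ?thesis
  proof
    assume "K = {\<zero>}"
    then show ?thesis using e_K[OF assms(2)] by simp
  next
    assume "K = carrier V"
    then have "x \<in> N" using assms(2) unfolding K_def by blast
    then show ?thesis by (rule e_N)
  qed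
qed

end

locale same_space =
  fixes M :: "(complex, 'v, 'x) module_scheme" and N :: "(complex, 'v, 'y) module_scheme"
  assumes vsM: "vectorspace class_ring M"
    and carrier_eq: "carrier N = carrier M" and add_eq: "add N = add M"
    and zero_eq: "zero N = zero M" and smult_eq: "smult N = smult M"
begin

sublocale M: cspace M using vsM by (simp add: cspace_def)

lemma vsN: "vectorspace class_ring N"
proof (rule vectorspace_classI; simp only: carrier_eq add_eq zero_eq smult_eq)
  show "\<exists>y\<in>carrier M. x \<oplus>\<^bsub>M\<^esub> y = \<zero>\<^bsub>M\<^esub>" if "x \<in> carrier M" for x
    using that M.M.r_neg M.M.a_inv_closed by blast
qed (auto simp: M.M.a_ac M.smult_add_left M.smult_add_right M.smult_mult)

sublocale N: cspace N using vsN by (simp add: cspace_def)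

lemma uminus_eq: "x \<in> carrier M \<Longrightarrow> \<ominus>\<^bsub>N\<^esub> x = \<ominus>\<^bsub>M\<^esub> x"
  using M.a_inv_smult[of x] N.a_inv_smult[of x] by (simp add: carrier_eq smult_eq)

lemma minus_eq: "x \<in> carrier M \<Longrightarrow> y \<in> carrier M \<Longrightarrow> x \<ominus>\<^bsub>N\<^esub> y = x \<ominus>\<^bsub>M\<^esub> y"
  by (simp add: a_minus_def uminus_eq add_eq)

lemma subspace_eq: "VectorSpace.subspace class_ring W N \<longleftrightarrow> VectorSpace.subspace class_ring W M"
proof
  assume W: "VectorSpace.subspace class_ring W N"
  show "VectorSpace.subspace class_ring W M"
    using N.subspaceD[OF W] by (intro M.subspaceI) (simp_all add: carrier_eq add_eq zero_eq smult_eq)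
next
  assume W: "VectorSpace.subspace class_ring W M"
  show "VectorSpace.subspace class_ring W N"
    using M.subspaceD[OF W] by (intro N.subspaceI) (simp_all add: carrier_eq add_eq zero_eq smult_eq)
qed

lemma linear_map_eq:
  assumes "linear_map class_ring M M f" shows "linear_map class_ring N N f" "linear_map class_ring M N f"
  using linear_map.T_im[OF assms] linear_map.T_add[OF assms] linear_map.T_smult[OF assms]
  by (intro linear_map_classI vsN vsM; simp add: carrier_eq add_eq smult_eq)+

lemma basis_eq: "N.basis A \<longleftrightarrow> M.basis A"
proof -
  have "finsum N f A = finsum M f A" for f :: "'v \<Rightarrow> 'v" and A
    by (simp add: finsum_def finprod_def carrier_eq add_eq zero_eq)
  then have "N.lincomb = M.lincomb"
    by (intro ext) (simp add: N.lincomb_def M.lincomb_def smult_eq)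
  then show ?thesis
    by (simp add: N.basis_def M.basis_def N.lin_dep_def M.lin_dep_def N.span_def M.span_def
        carrier_eq zero_eq)
qed

end

lemma simple_calibrated_inflated:
  fixes M :: "('v, A_gen) rep"
  assumes M: "A_rep M" "simple_rep M" "A_calibrated M"
  shows "\<exists>N :: ('v, H_gen) rep. H_rep N \<and> simple_rep N \<and> H_calibrated N \<and> rep_iso M (inflate N)"
proof -
  define L :: "('v, H_gen) rep" where
    "L = \<lparr>carrier = carrier M, mult = mult M, one = one M, zero = zero M, add = add M,
      smult = smult M,
      act = (\<lambda>g. case g of Hs \<Rightarrow> act M As | Hy1 \<Rightarrow> act M Ay1 | Hy2 \<Rightarrow> act M Ay2)\<rparr>"
  have vsM: "vectorspace class_ring M"
    using M(2) by (simp add: simple_rep_def operator_space_def)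
  obtain B where B: "vectorspace.basis class_ring M B"
    and diag: "\<forall>y\<in>{Ay1, Ay2}. \<forall>b\<in>B. \<exists>c. act M y b = c \<odot>\<^bsub>M\<^esub> b"
    using M(3) unfolding calibrated_def by blast
  interpret A_module M B
    by (rule A_module.intro[OF based_space.intro[OF cspace.intro[OF vsM]
          based_space_axioms.intro[OF B]] A_module_axioms.intro[OF M(1)]])
  have "same_space M L"
    by (rule same_space.intro[OF vsM]) (simp_all add: L_def)
  then interpret L: same_space M L .
  have "same_space M (inflate L)"
    by (rule same_space.intro[OF vsM]) (simp_all add: L_def inflate_def)
  then interpret I: same_space M "inflate L" .
  have act_L: "act L Hs = s" "act L Hy1 = y1" "act L Hy2 = y2" by (simp_all add: L_def)
  have e0: "x \<in> carrier M \<Longrightarrow> e x = \<zero>\<^bsub>M\<^esub>" for x by (rule e_zero_of_simple[OF M(2)])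
  have op: "operator_space L"
    unfolding operator_space_def
  proof (intro conjI allI L.vsN)
    show "linear_map class_ring L L (act L g)" for g
      by (cases g) (simp_all add: act_L L.linear_map_eq linear_act)
  qed
  have "H_rep L"
    unfolding H_rep_def Let_def act_L
  proof (intro conjI op ballI)
    fix x assume "x \<in> carrier L"
    then have x: "x \<in> carrier M" by (simp add: L.carrier_eq)
    show "s (s x) = x" by (rule s_s[OF x])
    show "y1 (y2 x) = y2 (y1 x)" by (rule y1_y2[OF x])
    show "s (y1 x) = y2 (s x) \<ominus>\<^bsub>L\<^esub> x"
      using x by (intro coord_ext) (simp_all add: L.minus_eq s_y1 e0)
    show "s (y2 x) = y1 (s x) \<oplus>\<^bsub>L\<^esub> x"
      using x by (intro coord_ext) (simp_all add: L.add_eq s_y2 e0)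
  qed
  moreover have "simple_rep L"
    unfolding simple_rep_def
  proof (intro conjI op allI impI)
    show "carrier L \<noteq> {\<zero>\<^bsub>L\<^esub>}"
      using M(2) by (simp add: simple_rep_def L.carrier_eq L.zero_eq)
    fix W assume W: "subrep W L"
    have WM: "VectorSpace.subspace class_ring W M"
      using W by (simp add: subrep_def L.subspace_eq)
    have "act M g w \<in> W" if w: "w \<in> W" for g w
    proof (cases g)
      case Ae
      then show ?thesis using e0[of w] subspaceD(1,2)[OF WM] w by auto
    qed (use W w act_L in \<open>auto simp: subrep_def simp flip: act_L\<close>)
    then have "subrep W M" using WM by (simp add: subrep_def)
    then show "W = {\<zero>\<^bsub>L\<^esub>} \<or> W = carrier L"
      using M(2) by (simp add: simple_rep_def L.carrier_eq L.zero_eq)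
  qed
  moreover have "H_calibrated L"
    unfolding calibrated_def using B diag L.basis_eq
    by (intro exI[of _ B]) (simp add: act_L L.smult_eq)
  moreover have "rep_iso M (inflate L)"
    unfolding rep_iso_def rep_hom_def
  proof (intro exI[of _ "\<lambda>x. x"] conjI allI ballI)
    show "linear_map class_ring M (inflate L) (\<lambda>x. x)"
      by (rule I.linear_map_eq(2), rule linear_map_classI) (use vsM in auto)
    show "act M g x = act (inflate L) g x" if "x \<in> carrier M" for g x
      using that e0 by (cases g) (simp_all add: inflate_def act_L, simp add: L_def)
    show "bij_betw (\<lambda>x. x) (carrier M) (carrier (inflate L))"
      by (simp add: I.carrier_eq bij_betw_def)
  qed
  ultimately show ?thesis by blast
qed

lemma calibrated_indecomposable:
  fixes V :: "('v, A_gen) rep"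
  assumes V: "A_rep V" "vectorspace.fin_dim class_ring V" "indecomposable_rep V" "A_calibrated V"
    and e: "\<exists>v\<in>carrier V. act V Ae v \<noteq> \<zero>\<^bsub>V\<^esub>"
  obtains B \<alpha> \<beta> where "split_module V B \<alpha> \<beta>"
proof -
  have vs: "vectorspace class_ring V"
    using V(3) by (simp add: indecomposable_rep_def operator_space_def)
  obtain B where B: "vectorspace.basis class_ring V B"
    and diag: "\<forall>y\<in>{Ay1, Ay2}. \<forall>b\<in>B. \<exists>c. act V y b = c \<odot>\<^bsub>V\<^esub> b"
    using V(4) unfolding calibrated_def by blast
  from diag obtain \<alpha> \<beta> where \<alpha>: "\<forall>b\<in>B. act V Ay1 b = \<alpha> b \<odot>\<^bsub>V\<^esub> b"
    and \<beta>: "\<forall>b\<in>B. act V Ay2 b = \<beta> b \<odot>\<^bsub>V\<^esub> b"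
    by (metis insertCI)
  interpret A_module V B
    by (rule A_module.intro[OF based_space.intro[OF cspace.intro[OF vs]
          based_space_axioms.intro[OF B]] A_module_axioms.intro[OF V(1)]])
  have "finite B" using fin_dim_li_fin[OF V(2)] is_basis by (simp add: basis_def)
  then interpret calibrated_A_module V B \<alpha> \<beta>
    by unfold_locales (use \<alpha> \<beta> in auto)
  have "split_module V B \<alpha> \<beta>"
    by unfold_locales (rule indecomposable_structure[OF V(3) e])+
  then show ?thesis by (rule that)
qed

theorem corollary12:
  "(\<forall>V :: ('v, A_gen) rep.
      A_rep V \<and> vectorspace.fin_dim class_ring V \<and> indecomposable_rep V \<and> A_calibrated V \<and>
      (\<exists>v\<in>carrier V. act V Ae v \<noteq> \<zero>\<^bsub>V\<^esub>)
      \<longrightarrow>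
      (\<forall>F. composition_factor V F \<longrightarrow> has_dim F 1) \<and>
      (\<exists>(k::nat) (l::nat) (a :: nat \<Rightarrow> complex) (b :: nat \<Rightarrow> complex).
         let K = direct_sum_rep {1..k} (\<lambda>i. V_minus (a i));
             Q = direct_sum_rep {1..l} (\<lambda>j. V_plus (b j - 1))
         in k \<ge> 1 \<and> l \<ge> 1 \<and> has_dim V (k + l) \<and>
            acts_by_diag V Ay1 (k + l) (\<lambda>i. if i \<le> k then a i else b (i - k) - 1) \<and>
            A_rep K \<and> semisimple_rep K \<and> A_rep Q \<and> semisimple_rep Q \<and>
            (\<exists>\<iota> \<pi>. short_exact K \<iota> V \<pi> Q)))
   \<and>
   (\<forall>M :: ('w, A_gen) rep.
      A_rep M \<and> simple_rep M \<and> A_calibrated M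
      \<longrightarrow>
      (\<exists>N :: ('w, H_gen) rep.
         H_rep N \<and> simple_rep N \<and> H_calibrated N \<and> rep_iso M (inflate N)))"
proof (rule conjI; intro allI impI; (elim conjE)?)
  fix V :: "('v, A_gen) rep"
  assume V: "A_rep V" "vectorspace.fin_dim class_ring V" "indecomposable_rep V" "A_calibrated V"
    and e: "\<exists>v\<in>carrier V. act V Ae v \<noteq> \<zero>\<^bsub>V\<^esub>"
  from calibrated_indecomposable[OF this] obtain B \<alpha> \<beta> where "split_module V B \<alpha> \<beta>" .
  then interpret split_module V B \<alpha> \<beta> .
  show "(\<forall>F. composition_factor V F \<longrightarrow> has_dim F 1) \<and>
      (\<exists>k l a b. let K = direct_sum_rep {1..k} (\<lambda>i. V_minus (a i));
             Q = direct_sum_rep {1..l} (\<lambda>j. V_plus (b j - 1))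
         in k \<ge> 1 \<and> l \<ge> 1 \<and> has_dim V (k + l) \<and>
            acts_by_diag V Ay1 (k + l) (\<lambda>i. if i \<le> k then a i else b (i - k) - 1) \<and>
            A_rep K \<and> semisimple_rep K \<and> A_rep Q \<and> semisimple_rep Q \<and>
            (\<exists>\<iota> \<pi>. short_exact K \<iota> V \<pi> Q))"
    using composition_factor_dim1 extension[OF e] by blast
next
  fix M :: "('w, A_gen) rep"
  assume "A_rep M" "simple_rep M" "A_calibrated M"
  then show "\<exists>N :: ('w, H_gen) rep. H_rep N \<and> simple_rep N \<and> H_calibrated N \<and> rep_iso M (inflate N)"
    by (rule simple_calibrated_inflated)
qed

end
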